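(* Consider the online ranking game with top-1 feedback where an oblivious adversary chooses $r_1,\dots,r_T\in\{0,1,\dots,n\}^m$. Let the learner run algorithm RTop-1F (described in the context, with relevance values transformed by $g(x)=2^x-1$) with $K=m^{-1/3}T^{2/3}$ and $\epsilon=\sqrt{1/((2^n-1)^2mK)}$. Then $$\mathbb{E}\Big[\sum_{t=1}^T DCG(\sigma_t,r_t)\Big]\ge\max_\sigma\sum_{t=1}^T DCG(\sigma,r_t)-O\big((2^n-1)m^{5/3}T^{2/3}\big),$$ the expectation being over the learner's random actions. In the binary case ($n=1$) the regret term is $O(m^{5/3}T^{2/3})$. Moreover, since local observability fails for DCG with top-1 feedback, there is a matching lower bound: for $m=3$ and binary relevance, for every learner algorithm there is an adversary for which the expected regret is $\Omega(T^{2/3})$.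
   Context: Objects are $\{1,\dots,m\}$; a ranking is a permutation $\sigma$ of $[m]$ with $\sigma(i)$ the rank of object $i$ and $\sigma^{-1}(j)$ the object at rank $j$. $DCG(\sigma,r)=\sum_{i=1}^m\frac{2^{r(i)}-1}{\log_2(1+\sigma(i))}$ (a gain). Regret is $\max_\sigma\sum_t DCG(\sigma,r_t)-\mathbb{E}\sum_tDCG(\sigma_t,r_t)$. Game: the oblivious adversary fixes $r_1,\dots,r_T$ in advance; at round $t$ the learner outputs $\sigma_t$ and observes only $r_t(\sigma_t^{-1}(1))$. Algorithm RTop-1F with parameters $K,\epsilon$: split $\{1,\dots,T\}$ into $K$ consecutive blocks $B_i=\{(i-1)T/K+1,\dots,iT/K\}$. Initialize $\hat s_0=\hat r_0=0\in\mathbb{R}^m$. For $i=1,\dots,K$: set $\hat s_i=\hat s_{i-1}+\hat r_{i-1}$; choose $m$ distinct time points $i_1,\dots,i_m$ from $B_i$ uniformly at random without replacement; for each $t\in B_i$: if $t=i_j$, output any permutation placing object $j$ at rank 1 and receive $r_{i_j}(j)$; otherwise sample $p_t$ uniformly from $[0,1/\epsilon]^m$ and output $\sigma_t=\arg\min_\sigma\sigma\cdot(\hat s_i+p_t)$ (here $\sigma$ is identified with $(\sigma(1),\dots,\sigma(m))$). At the end of the block set $\hat r_i=(2^{r_{i_1}(1)}-1,\dots,2^{r_{i_m}(m)}-1)$. *)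

theory Defs
  imports "HOL-Probability.Probability" "HOL-Combinatorics.Permutations"
begin

text \<open>Objects are 1..m; a ranking is a permutation sigma of {1..m}, sigma i = rank of object i.
  A relevance vector is r :: nat => nat (r i = relevance of object i).
  An adversary's sequence is rs :: nat => nat => nat, rs t = relevance vector of round t (t = 1..T).\<close>

definition dcg :: "nat \<Rightarrow> (nat \<Rightarrow> nat) \<Rightarrow> (nat \<Rightarrow> nat) \<Rightarrow> real" where
  "dcg m \<sigma> r = (\<Sum>i=1..m. (2 ^ r i - 1) / log 2 (1 + real (\<sigma> i)))"

definition best_total :: "nat \<Rightarrow> nat \<Rightarrow> (nat \<Rightarrow> nat \<Rightarrow> nat) \<Rightarrow> real" where
  "best_total m T rs = Max {(\<Sum>t=1..T. dcg m \<sigma> (rs t)) | \<sigma>. \<sigma> permutes {1..m}}"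

definition block :: "nat \<Rightarrow> nat \<Rightarrow> nat \<Rightarrow> nat set" where
  "block T K i = {(i - 1) * (T div K) + 1 .. i * (T div K)}"

definition block_of :: "nat \<Rightarrow> nat \<Rightarrow> nat \<Rightarrow> nat" where
  "block_of T K t = (t - 1) div (T div K) + 1"

definition argmin_perm :: "nat \<Rightarrow> (nat \<Rightarrow> real) \<Rightarrow> (nat \<Rightarrow> nat)" where
  "argmin_perm m s = (SOME \<sigma>. \<sigma> permutes {1..m} \<and>
     (\<forall>\<tau>. \<tau> permutes {1..m} \<longrightarrow> (\<Sum>i=1..m. real (\<sigma> i) * s i) \<le> (\<Sum>i=1..m. real (\<tau> i) * s i)))"

text \<open>Exploration schedule of block i: an injection j |-> i_j from {1..m} into the block,
  chosen uniformly at random (m distinct time points without replacement, i_j for object j).\<close>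
definition explore_choices :: "nat \<Rightarrow> nat \<Rightarrow> nat \<Rightarrow> nat \<Rightarrow> (nat \<Rightarrow> nat) set" where
  "explore_choices m T K i = {f \<in> {1..m} \<rightarrow>\<^sub>E block T K i. inj_on f {1..m}}"

definition explore_pmf :: "nat \<Rightarrow> nat \<Rightarrow> nat \<Rightarrow> (nat \<Rightarrow> nat \<Rightarrow> nat) pmf" where
  "explore_pmf m T K = Pi_pmf {1..K} (\<lambda>_. undefined) (\<lambda>i. pmf_of_set (explore_choices m T K i))"

text \<open>Perturbations p_t uniform on [0,1/eps]^m, independent over t: component (t,j) is p_t(j).\<close>
definition perturb_measure :: "nat \<Rightarrow> nat \<Rightarrow> real \<Rightarrow> (nat \<times> nat \<Rightarrow> real) measure" where
  "perturb_measure m T \<epsilon> = PiM ({1..T} \<times> {1..m}) (\<lambda>_. uniform_measure lborel {0..1/\<epsilon>})"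

definition rtop1f_space :: "nat \<Rightarrow> nat \<Rightarrow> nat \<Rightarrow> real \<Rightarrow> ((nat \<Rightarrow> nat \<Rightarrow> nat) \<times> (nat \<times> nat \<Rightarrow> real)) measure" where
  "rtop1f_space m T K \<epsilon> = measure_pmf (explore_pmf m T K) \<Otimes>\<^sub>M perturb_measure m T \<epsilon>"

definition rhat :: "(nat \<Rightarrow> nat \<Rightarrow> nat) \<Rightarrow> (nat \<Rightarrow> nat \<Rightarrow> nat) \<Rightarrow> nat \<Rightarrow> nat \<Rightarrow> real" where
  "rhat rs I k j = 2 ^ rs (I k j) j - 1"

definition shat :: "(nat \<Rightarrow> nat \<Rightarrow> nat) \<Rightarrow> (nat \<Rightarrow> nat \<Rightarrow> nat) \<Rightarrow> nat \<Rightarrow> nat \<Rightarrow> real" where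
  "shat rs I i j = (\<Sum>k\<in>{1..<i}. rhat rs I k j)"

text \<open>Ranking output at round t.  expl t j is the (arbitrary) permutation used when
  exploring object j at time t; it must place j at rank 1.\<close>
definition rtop1f_action :: "nat \<Rightarrow> nat \<Rightarrow> nat \<Rightarrow> (nat \<Rightarrow> nat \<Rightarrow> nat \<Rightarrow> nat) \<Rightarrow>
    (nat \<Rightarrow> nat \<Rightarrow> nat) \<Rightarrow> nat \<Rightarrow> (nat \<Rightarrow> nat \<Rightarrow> nat) \<times> (nat \<times> nat \<Rightarrow> real) \<Rightarrow> (nat \<Rightarrow> nat)" where
  "rtop1f_action m T K expl rs t \<omega> =
     (let I = fst \<omega>; p = snd \<omega>; b = block_of T K t in
      if \<exists>j\<in>{1..m}. I b j = t then expl t (THE j. j \<in> {1..m} \<and> I b j = t)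
      else argmin_perm m (\<lambda>j. shat rs I b j + p (t, j)))"

definition rtop1f_expected_total :: "nat \<Rightarrow> nat \<Rightarrow> nat \<Rightarrow> real \<Rightarrow> (nat \<Rightarrow> nat \<Rightarrow> nat \<Rightarrow> nat) \<Rightarrow>
    (nat \<Rightarrow> nat \<Rightarrow> nat) \<Rightarrow> real" where
  "rtop1f_expected_total m T K \<epsilon> expl rs =
     (\<integral>\<omega>. (\<Sum>t=1..T. dcg m (rtop1f_action m T K expl rs t \<omega>) (rs t)) \<partial>rtop1f_space m T K \<epsilon>)"

text \<open>A learner maps the history (list of past (ranking, observed top-1 relevance) pairs)
  to a distribution over the next ranking.\<close>
type_synonym learner = "((nat \<Rightarrow> nat) \<times> nat) list \<Rightarrow> (nat \<Rightarrow> nat) pmf"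

definition valid_learner :: "nat \<Rightarrow> learner \<Rightarrow> bool" where
  "valid_learner m L \<longleftrightarrow> (\<forall>h. set_pmf (L h) \<subseteq> {\<sigma>. \<sigma> permutes {1..m}})"

primrec play :: "learner \<Rightarrow> (nat \<Rightarrow> nat \<Rightarrow> nat) \<Rightarrow> nat \<Rightarrow> ((nat \<Rightarrow> nat) \<times> nat) list pmf" where
  "play L rs 0 = return_pmf []"
| "play L rs (Suc t) = do { h \<leftarrow> play L rs t; \<sigma> \<leftarrow> L h;
                           return_pmf (h @ [(\<sigma>, rs (Suc t) (inv \<sigma> 1))]) }"

definition learner_expected_total :: "nat \<Rightarrow> learner \<Rightarrow> nat \<Rightarrow> (nat \<Rightarrow> nat \<Rightarrow> nat) \<Rightarrow> real" where
  "learner_expected_total m L T rs =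
     measure_pmf.expectation (play L rs T) (\<lambda>h. \<Sum>t=1..T. dcg m (fst (h ! (t - 1))) (rs t))"

end

theory Submission
  imports Defs
begin

text \<open>
  Upper bound. At most \<open>K m\<close> rounds explore, each costing at most \<open>m (2^n - 1)\<close>. On the other rounds
  the algorithm is follow-the-perturbed-leader on the block estimates: the estimate of a block is
  independent of the scores used in that block, and its mean is the block average of the transformed
  relevances, so the regret is \<open>T / K\<close> times the regret of the perturbed leader over \<open>K\<close> rounds. The
  latter is at most \<open>m / \<epsilon>\<close> (be the leader) plus \<open>K \<epsilon> (m (2^n - 1))\<^sup>2\<close>, because shifting the uniform
  perturbation by one estimate changes expectations of functions in \<open>[0, H]\<close> by at most
  \<open>H \<epsilon>\<close> times the \<open>l\<^sub>1\<close> norm of the shift. The parameters balance the three terms.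

  Lower bound. Object 1 is always relevant, and a coin of bias \<open>1/2 + \<delta>\<close>, \<open>1/2 - \<delta>\<close> or \<open>1/2\<close> decides which
  of objects 2 and 3 is. Only a ranking without object 1 on top reveals the coin, at constant cost.
  Either the learner explores \<open>T powr (2/3)\<close> times on the fair coin, or with
  \<open>\<delta> = T powr (-1/3) / 4\<close> it cannot tell the two biased coins apart and pays \<open>\<delta>\<close> in a constant
  fraction of the rounds for one of them.
\<close>

section \<open>Expectations of finitely supported distributions\<close>

lemma pmf_expectation_cong:
  assumes "\<And>x. x \<in> set_pmf p \<Longrightarrow> f x = (g x :: real)"
  shows "measure_pmf.expectation p f = measure_pmf.expectation p g"
  by (intro integral_cong_AE) (auto simp: AE_measure_pmf_iff assms)

lemma expectation_bind_finite:
  fixes h :: "'b \<Rightarrow> real"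
  assumes "finite (set_pmf p)" "\<And>x. x \<in> set_pmf p \<Longrightarrow> finite (set_pmf (f x))"
  shows "measure_pmf.expectation (p \<bind> f) h
       = measure_pmf.expectation p (\<lambda>x. measure_pmf.expectation (f x) h)"
proof -
  have "measure_pmf.expectation (p \<bind> f) h
      = (\<Sum>a\<in>set_pmf p. pmf p a *\<^sub>R measure_pmf.expectation (f a) h)"
    by (rule pmf_expectation_bind) (use assms in auto)
  also have "\<dots> = measure_pmf.expectation p (\<lambda>x. measure_pmf.expectation (f x) h)"
    by (subst integral_measure_pmf_real[OF assms(1)]) (auto simp: mult.commute)
  finally show ?thesis .
qed

lemma pmf_expectation_mono:
  assumes "finite (set_pmf p)" "\<And>x. x \<in> set_pmf p \<Longrightarrow> f x \<le> (g x :: real)"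
  shows "measure_pmf.expectation p f \<le> measure_pmf.expectation p g"
  by (intro integral_mono_AE integrable_measure_pmf_finite assms(1))
    (auto simp: AE_measure_pmf_iff assms)

text \<open>The probabilistic method: it later extracts one fixed relevance sequence from a random
  adversary that is bad on average.\<close>

lemma pmf_expectation_attained:
  fixes f :: "'a \<Rightarrow> real"
  assumes "finite (set_pmf p)"
  shows "\<exists>x\<in>set_pmf p. measure_pmf.expectation p f \<le> f x"
proof -
  have *: "Max (f ` set_pmf p) \<in> f ` set_pmf p"
    using assms set_pmf_not_empty[of p] by (intro Max_in) auto
  have "measure_pmf.expectation p f \<le> Max (f ` set_pmf p)"
    using assms by (intro measure_pmf.integral_le_const integrable_measure_pmf_finite)
      (auto simp: AE_measure_pmf_iff)
  with * show ?thesis by auto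
qed

section \<open>Follow the perturbed leader\<close>

text \<open>\<open>dcg\<close> with an arbitrary real vector in place of the transformed relevances.
  It is linear in \<open>v\<close>, so cumulative estimates and perturbations can be fed to it and
  split off again.\<close>

definition gain :: "nat \<Rightarrow> (nat \<Rightarrow> nat) \<Rightarrow> (nat \<Rightarrow> real) \<Rightarrow> real" where
  "gain m \<sigma> v = (\<Sum>i=1..m. v i / log 2 (1 + real (\<sigma> i)))"

lemma dcg_eq_gain: "dcg m \<sigma> r = gain m \<sigma> (\<lambda>i. 2 ^ r i - 1)"
  by (simp add: dcg_def gain_def)

lemma gain_add: "gain m \<sigma> (\<lambda>i. u i + v i) = gain m \<sigma> u + gain m \<sigma> v"
  by (simp add: gain_def add_divide_distrib sum.distrib)

lemma gain_bounds:
  assumes "\<And>i. i \<in> {1..m} \<Longrightarrow> 0 \<le> v i" "\<And>i. i \<in> {1..m} \<Longrightarrow> v i \<le> G"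
  shows "0 \<le> gain m \<sigma> v" "gain m \<sigma> v \<le> real m * G"
proof -
  have *: "0 \<le> v i / log 2 (1 + real (\<sigma> i))" "v i / log 2 (1 + real (\<sigma> i)) \<le> G" if "i \<in> {1..m}" for i
  proof -
    show 1: "0 \<le> v i / log 2 (1 + real (\<sigma> i))" using assms[OF that] by simp
    show "v i / log 2 (1 + real (\<sigma> i)) \<le> G"
    \<comment> \<open>\<open>\<sigma>\<close> is an arbitrary function here, so rank 0 can occur;
      the denominator is then \<open>log 2 1 = 0\<close> and the quotient is 0.\<close>
    proof (cases "\<sigma> i = 0")
      case True
      then show ?thesis using assms[OF that] by simp
    next
      case False
      then have "log 2 2 \<le> log 2 (1 + real (\<sigma> i))" by (subst log_le_cancel_iff) auto
      then have "v i / log 2 (1 + real (\<sigma> i)) \<le> v i / 1"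
        using assms[OF that] by (intro divide_left_mono) auto
      then show ?thesis using assms[OF that] by simp
    qed
  qed
  show "0 \<le> gain m \<sigma> v" unfolding gain_def using * by (intro sum_nonneg) auto
  have "gain m \<sigma> v \<le> (\<Sum>i=1..m. G)" unfolding gain_def using * by (intro sum_mono) auto
  then show "gain m \<sigma> v \<le> real m * G" by simp
qed

section \<open>Minimising the score product sorts the objects\<close>

lemma sum_transpose_diff:
  fixes f :: "nat \<Rightarrow> real"
  assumes "finite A" "i \<in> A" "j \<in> A" "i \<noteq> j"
  shows "(\<Sum>k\<in>A. f ((\<sigma> \<circ> Transposition.transpose i j) k) * s k) - (\<Sum>k\<in>A. f (\<sigma> k) * s k)
    = (f (\<sigma> i) - f (\<sigma> j)) * (s j - s i)"
proof -
  let ?d = "\<lambda>k. f ((\<sigma> \<circ> Transposition.transpose i j) k) * s k - f (\<sigma> k) * s k"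
  have "sum ?d A = sum ?d {i, j}"
    using assms by (intro sum.mono_neutral_right) (auto simp: transpose_apply_other)
  also have "\<dots> = (f (\<sigma> i) - f (\<sigma> j)) * (s j - s i)"
    using assms by (simp add: algebra_simps)
  finally show ?thesis by (simp add: sum_subtractf)
qed

text \<open>Exchange argument: if an object with a larger score had the later rank, swapping the two
  would strictly increase the objective. The weight \<open>f\<close> is left general so that the
  lemma serves both the discount and \<open>- k\<close>, the weight that \<open>argmin_perm\<close>
  optimises.\<close>

lemma maximiser_sorts:
  fixes f s :: "nat \<Rightarrow> real"
  assumes \<sigma>: "\<sigma> permutes {1..m}"
    and opt: "\<And>\<tau>. \<tau> permutes {1..m} \<Longrightarrow> (\<Sum>k=1..m. f (\<tau> k) * s k) \<le> (\<Sum>k=1..m. f (\<sigma> k) * s k)"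
    and f: "\<And>k l. 1 \<le> k \<Longrightarrow> k < l \<Longrightarrow> f l < f k"
    and ij: "i \<in> {1..m}" "j \<in> {1..m}" "s j < s i"
  shows "\<sigma> i < \<sigma> j"
proof (rule ccontr)
  assume "\<not> \<sigma> i < \<sigma> j"
  moreover have "\<sigma> i \<noteq> \<sigma> j" using ij permutes_inj[OF \<sigma>] by (auto simp: inj_eq)
  ultimately have "\<sigma> j < \<sigma> i" by simp
  moreover have "1 \<le> \<sigma> j" using permutes_in_image[OF \<sigma>, of j] ij by simp
  ultimately have "f (\<sigma> i) < f (\<sigma> j)" by (intro f)
  then have "0 < (f (\<sigma> i) - f (\<sigma> j)) * (s j - s i)" using ij by (intro mult_neg_neg) auto
  also have "\<dots> = (\<Sum>k=1..m. f ((\<sigma> \<circ> Transposition.transpose i j) k) * s k) - (\<Sum>k=1..m. f (\<sigma> k) * s k)"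
    using ij by (intro sum_transpose_diff[symmetric]) auto
  also have "\<dots> \<le> 0"
    using opt[OF permutes_compose[OF permutes_swap_id[OF ij(1,2)] \<sigma>]] by simp
  finally show False by simp
qed

text \<open>Two sorting permutations may break ties differently, but both list the scores in order,
  and the sorted list of a multiset is unique.\<close>

lemma sorted_by_permutation_unique:
  fixes s :: "nat \<Rightarrow> real"
  assumes perm: "\<sigma> permutes {1..m}" "\<tau> permutes {1..m}"
    and sorts: "\<And>i j. i \<in> {1..m} \<Longrightarrow> j \<in> {1..m} \<Longrightarrow> s j < s i \<Longrightarrow> \<sigma> i < \<sigma> j"
      "\<And>i j. i \<in> {1..m} \<Longrightarrow> j \<in> {1..m} \<Longrightarrow> s j < s i \<Longrightarrow> \<tau> i < \<tau> j"
    and k: "k \<in> {1..m}"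
  shows "s (inv \<sigma> k) = s (inv \<tau> k)"
proof -
  \<comment> \<open>The scores are negated because \<open>sort\<close> is ascending while early
    ranks carry large scores.\<close>
  define xs where "xs \<rho> = map (\<lambda>k. - s (inv \<rho> k)) [1..<Suc m]" for \<rho>
  have sort: "sort (map (\<lambda>i. - s i) [1..<Suc m]) = xs \<rho>"
    if \<rho>: "\<rho> permutes {1..m}"
      and srt: "\<And>i j. i \<in> {1..m} \<Longrightarrow> j \<in> {1..m} \<Longrightarrow> s j < s i \<Longrightarrow> \<rho> i < \<rho> j" for \<rho>
  proof (rule properties_for_sort)
    have "image_mset (inv \<rho>) (mset_set {1..m}) = mset_set (inv \<rho> ` {1..m})"
      using permutes_inj_on[OF permutes_inv[OF \<rho>]] by (rule image_mset_mset_set)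
    also have "inv \<rho> ` {1..m} = {1..m}" using permutes_image[OF permutes_inv[OF \<rho>]] .
    finally have *: "image_mset (inv \<rho>) (mset_set {1..m}) = mset_set {1..m}" .
    have "mset (xs \<rho>) = image_mset (\<lambda>i. - s i) (image_mset (inv \<rho>) (mset_set {1..m}))"
      by (simp add: xs_def multiset.map_comp o_def atLeastLessThanSuc_atLeastAtMost del: upt_Suc)
    then show "mset (xs \<rho>) = mset (map (\<lambda>i. - s i) [1..<Suc m])"
      unfolding * by (simp add: atLeastLessThanSuc_atLeastAtMost del: upt_Suc)
    have "- s (inv \<rho> k) \<le> - s (inv \<rho> l)" if "k \<in> {1..m}" "l \<in> {1..m}" "k < l" for k l
    proof (rule ccontr)
      assume "\<not> ?thesis"
      then have "s (inv \<rho> k) < s (inv \<rho> l)" by simp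
      moreover have "inv \<rho> k \<in> {1..m}" "inv \<rho> l \<in> {1..m}"
        using permutes_in_image[OF permutes_inv[OF \<rho>]] that by auto
      ultimately have "\<rho> (inv \<rho> l) < \<rho> (inv \<rho> k)" by (intro srt)
      then show False using that permutes_inverses(1)[OF \<rho>] by simp
    qed
    then show "sorted (xs \<rho>)"
      unfolding xs_def sorted_wrt_map by (auto simp: sorted_wrt_iff_nth_less simp del: upt_Suc)
  qed
  have "xs \<sigma> = xs \<tau>" using sort[OF perm(1) sorts(1)] sort[OF perm(2) sorts(2)] by simp
  then have "map (\<lambda>k. s (inv \<sigma> k)) [1..<Suc m] = map (\<lambda>k. s (inv \<tau> k)) [1..<Suc m]"
    by (simp add: xs_def del: upt_Suc)
  then show ?thesis using k by (auto simp del: upt_Suc)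
qed

lemma argmin_perm:
  shows argmin_perm_permutes: "argmin_perm m s permutes {1..m}"
    and argmin_perm_le: "\<tau> permutes {1..m} \<Longrightarrow>
      (\<Sum>i=1..m. real (argmin_perm m s i) * s i) \<le> (\<Sum>i=1..m. real (\<tau> i) * s i)"
proof -
  let ?f = "\<lambda>\<tau>. \<Sum>i=1..m. real (\<tau> i) * s i" and ?P = "{\<sigma>. \<sigma> permutes {1..m}}"
  have "finite ?P" "?P \<noteq> {}" using finite_permutations[of "{1..m}"] permutes_id[of "{1..m}"] by blast+
  then have "Min (?f ` ?P) \<in> ?f ` ?P" "\<forall>\<tau>\<in>?P. Min (?f ` ?P) \<le> ?f \<tau>" by (auto intro!: Min_in)
  then have "\<exists>\<sigma>. \<sigma> permutes {1..m} \<and> (\<forall>\<tau>. \<tau> permutes {1..m} \<longrightarrow> ?f \<sigma> \<le> ?f \<tau>)" by force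
  from someI_ex[OF this] show "argmin_perm m s permutes {1..m}"
    and "\<tau> permutes {1..m} \<Longrightarrow> ?f (argmin_perm m s) \<le> ?f \<tau>"
    unfolding argmin_perm_def by blast+
qed

lemma argmin_perm_cong:
  assumes "\<And>i. i \<in> {1..m} \<Longrightarrow> s i = s' i"
  shows "argmin_perm m s = argmin_perm m s'"
proof -
  have "(\<Sum>i=1..m. real (\<sigma> i) * s i) = (\<Sum>i=1..m. real (\<sigma> i) * s' i)" for \<sigma>
    using assms by (intro sum.cong) auto
  then show ?thesis unfolding argmin_perm_def by simp
qed

text \<open>The algorithm minimises \<open>\<sigma> \<cdot> s\<close>, but what is needed is that it maximises the
  discounted gain: both optima sort the objects by score, and the sorted score list is unique.\<close>

lemma gain_le_argmin_perm:
  assumes "\<tau> permutes {1..m}"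
  shows "gain m \<tau> s \<le> gain m (argmin_perm m s) s"
proof -
  let ?P = "{\<sigma>. \<sigma> permutes {1..m}}"
  let ?f = "\<lambda>k. 1 / log 2 (1 + real k)"
  let ?\<sigma> = "argmin_perm m s"
  have fin: "finite ?P" using finite_permutations[of "{1..m}"] by auto
  have "Max ((\<lambda>\<sigma>. gain m \<sigma> s) ` ?P) \<in> (\<lambda>\<sigma>. gain m \<sigma> s) ` ?P"
    using fin assms by (intro Max_in) auto
  then obtain \<rho> where \<rho>: "\<rho> permutes {1..m}" "gain m \<rho> s = Max ((\<lambda>\<sigma>. gain m \<sigma> s) ` ?P)" by auto
  have opt: "gain m \<tau> s \<le> gain m \<rho> s" if "\<tau> permutes {1..m}" for \<tau>
    unfolding \<rho>(2) using fin that by (intro Max_ge) auto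
  have g: "gain m \<sigma> s = (\<Sum>k=1..m. ?f (\<sigma> k) * s k)" for \<sigma> by (simp add: gain_def)
  have "\<rho> i < \<rho> j" if "i \<in> {1..m}" "j \<in> {1..m}" "s j < s i" for i j
  proof (rule maximiser_sorts[OF \<rho>(1) _ _ that, of ?f])
    show "1 / log 2 (1 + real l) < 1 / log 2 (1 + real k)" if "1 \<le> k" "k < l" for k l :: nat
      using that by (intro divide_strict_left_mono mult_pos_pos) auto
  qed (use opt in \<open>simp add: g\<close>)
  moreover have "?\<sigma> i < ?\<sigma> j" if "i \<in> {1..m}" "j \<in> {1..m}" "s j < s i" for i j
    using argmin_perm_le[of _ m s]
    by (intro maximiser_sorts[OF argmin_perm_permutes _ _ that, of "\<lambda>k. - real k"])
      (auto simp: sum_negf)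
  ultimately have eq: "s (inv \<rho> k) = s (inv ?\<sigma> k)" if "k \<in> {1..m}" for k
    using that by (intro sorted_by_permutation_unique[OF \<rho>(1) argmin_perm_permutes]) auto
  \<comment> \<open>Summed over ranks instead of objects, the gain sees only the list of scores in
    rank order, which is the same for both optima.\<close>
  have gain_inv: "gain m \<sigma> s = (\<Sum>k=1..m. s (inv \<sigma> k) / log 2 (1 + real k))"
    if "\<sigma> permutes {1..m}" for \<sigma>
    unfolding gain_def
    by (subst sum.permute[OF permutes_inv[OF that]]) (simp add: o_def permutes_inverses[OF that])
  have "gain m \<rho> s = gain m ?\<sigma> s"
    unfolding gain_inv[OF \<rho>(1)] gain_inv[OF argmin_perm_permutes] using eq by (intro sum.cong) auto
  then show ?thesis using opt[OF assms] by simp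
qed

section \<open>Measurability of the chosen ranking\<close>

text \<open>The Hilbert choice depends on the sample only through the set \<open>Opt\<close> of
  optimal permutations. That set takes finitely many values, and each value is cut out by finitely
  many inequalities between measurable functions.\<close>

lemma measurable_argmin_perm:
  fixes X :: "'a \<Rightarrow> nat \<Rightarrow> real"
  assumes [measurable]: "\<And>j. j \<in> {1..m} \<Longrightarrow> (\<lambda>\<omega>. X \<omega> j) \<in> borel_measurable M"
  shows "(\<lambda>\<omega>. argmin_perm m (X \<omega>)) \<in> measurable M (count_space UNIV)"
proof -
  define P where "P = {\<sigma>. \<sigma> permutes {1..m}}"
  let ?f = "\<lambda>\<tau> \<omega>. \<Sum>i=1..m. real (\<tau> i) * X \<omega> i"
  define Opt where "Opt \<omega> = {\<sigma>\<in>P. \<forall>\<tau>\<in>P. ?f \<sigma> \<omega> \<le> ?f \<tau> \<omega>}" for \<omega>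
  have fin: "finite P" using finite_permutations[of "{1..m}"] by (auto simp: P_def)
  have f[measurable]: "(\<lambda>\<omega>. ?f \<tau> \<omega>) \<in> borel_measurable M" for \<tau>
    using assms by (intro borel_measurable_sum borel_measurable_times) auto
  have Opt: "Opt \<in> measurable M (count_space (Pow P))"
  proof (subst measurable_count_space_eq2)
    show "finite (Pow P)" using fin by simp
    have "Opt -` {A} \<inter> space M \<in> sets M" if "A \<subseteq> P" for A
    proof -
      have "Opt -` {A} \<inter> space M = {\<omega>\<in>space M. \<forall>\<sigma>\<in>P. \<sigma> \<in> A \<longleftrightarrow> (\<forall>\<tau>\<in>P. ?f \<sigma> \<omega> \<le> ?f \<tau> \<omega>)}"
        using that unfolding Opt_def by blast
      also have "\<dots> \<in> sets M"
      proof (intro sets.sets_Collect_finite_All[OF _ fin])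
        fix \<sigma>
        have "{\<omega>\<in>space M. \<forall>\<tau>\<in>P. ?f \<sigma> \<omega> \<le> ?f \<tau> \<omega>} \<in> sets M"
          by (intro sets.sets_Collect_finite_All[OF _ fin] borel_measurable_le f)
        then show "{\<omega>\<in>space M. (\<sigma> \<in> A) = (\<forall>\<tau>\<in>P. ?f \<sigma> \<omega> \<le> ?f \<tau> \<omega>)} \<in> sets M"
          using sets.sets_Collect_neg by (cases "\<sigma> \<in> A") (simp_all only: simp_thms)
      qed
      finally show ?thesis .
    qed
    then show "Opt \<in> space M \<rightarrow> Pow P \<and> (\<forall>a\<in>Pow P. Opt -` {a} \<inter> space M \<in> sets M)"
      by (auto simp: Opt_def)
  qed
  have "(\<lambda>\<omega>. SOME \<sigma>. \<sigma> \<in> Opt \<omega>) \<in> measurable M (count_space UNIV)"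
    by (rule measurable_compose[OF Opt]) simp
  moreover have "argmin_perm m (X \<omega>) = (SOME \<sigma>. \<sigma> \<in> Opt \<omega>)" for \<omega>
    by (simp add: argmin_perm_def Opt_def P_def)
  ultimately show ?thesis by simp
qed

section \<open>Shifting a uniform perturbation\<close>

abbreviation uniform_upto :: "real \<Rightarrow> real measure" where
  "uniform_upto L \<equiv> uniform_measure lborel {0..L}"

lemma prob_space_uniform_upto: "0 < L \<Longrightarrow> prob_space (uniform_upto L)"
  by (intro prob_space_uniform_measure) auto

text \<open>Translation turns the shift into integration over \<open>{v..L + v}\<close>. This
  interval leaves \<open>{0..L}\<close> only in a piece of length \<open>v\<close>, which has mass
  \<open>v / L\<close> and where \<open>h\<close> is at most \<open>H\<close>.\<close>

lemma nn_integral_uniform_shift: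
  fixes h :: "real \<Rightarrow> ennreal"
  assumes h[measurable]: "h \<in> borel_measurable borel" and bnd: "\<And>x. h x \<le> ennreal H"
    and "0 < L" "0 \<le> v" "0 \<le> H"
  shows "(\<integral>\<^sup>+x. h (x + v) \<partial>uniform_upto L) \<le> (\<integral>\<^sup>+x. h x \<partial>uniform_upto L) + ennreal (H * v / L)"
proof -
  have "(\<integral>\<^sup>+x. h (x + v) * indicator {0..L} x \<partial>lborel) = (\<integral>\<^sup>+x. h (v + x) * indicator {v..L + v} (v + x) \<partial>lborel)"
    by (intro nn_integral_cong) (auto simp: indicator_def add.commute)
  also have "\<dots> = (\<integral>\<^sup>+y. h y * indicator {v..L + v} y \<partial>distr lborel borel ((+) v))"
    by (subst nn_integral_distr) auto
  also have "\<dots> = (\<integral>\<^sup>+y. h y * indicator {v..L + v} y \<partial>lborel)"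
    by (simp add: lborel_distr_plus)
  also have "\<dots> \<le> (\<integral>\<^sup>+y. h y * indicator {0..L} y + ennreal H * indicator {L..L + v} y \<partial>lborel)"
    using bnd assms by (intro nn_integral_mono) (auto simp: indicator_def)
  also have "\<dots> = (\<integral>\<^sup>+y. h y * indicator {0..L} y \<partial>lborel) + ennreal (H * v)"
    using assms by (subst nn_integral_add) (auto simp: nn_integral_cmult_indicator ennreal_mult)
  finally have "(\<integral>\<^sup>+x. h (x + v) * indicator {0..L} x \<partial>lborel) / ennreal L
      \<le> ((\<integral>\<^sup>+y. h y * indicator {0..L} y \<partial>lborel) + ennreal (H * v)) / ennreal L"
    by (rule divide_right_mono_ennreal)
  also have "\<dots> = (\<integral>\<^sup>+y. h y * indicator {0..L} y \<partial>lborel) / ennreal L + ennreal (H * v / L)"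
    using assms by (simp add: add_divide_distrib_ennreal divide_ennreal)
  finally show ?thesis
    using assms by (simp add: nn_integral_uniform_measure)
qed

text \<open>The coordinates are shifted one at a time, by induction on the index set. Integrating
  out the new coordinate leaves a function \<open>g\<close> that is still bounded by
  \<open>H\<close>, so every coordinate costs \<open>H * v i / L\<close> and the costs add
  up.\<close>

lemma nn_integral_PiM_uniform_shift:
  fixes h :: "('i \<Rightarrow> real) \<Rightarrow> ennreal"
  assumes "finite J" "h \<in> borel_measurable (PiM J (\<lambda>_. borel))" "\<And>x. h x \<le> ennreal H"
    and L: "0 < L" and v: "\<And>j. j \<in> J \<Longrightarrow> 0 \<le> v j" and H: "0 \<le> H"
  shows "(\<integral>\<^sup>+x. h (\<lambda>j\<in>J. x j + v j) \<partial>PiM J (\<lambda>_. uniform_upto L))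
       \<le> (\<integral>\<^sup>+x. h x \<partial>PiM J (\<lambda>_. uniform_upto L)) + ennreal (H * (\<Sum>j\<in>J. v j) / L)"
  using assms(1-3) v
proof (induction J arbitrary: h rule: finite_induct)
  case empty
  show ?case by (simp add: PiM_empty nn_integral_count_space_finite)
next
  case (insert i J)
  let ?U = "uniform_upto L"
  have U: "prob_space ?U" by (rule prob_space_uniform_upto[OF L])
  interpret product_prob_space "\<lambda>_::'i. ?U" UNIV
    by (simp add: product_prob_space_def product_sigma_finite_def product_prob_space_axioms_def U
        prob_space_imp_sigma_finite)
  interpret PJ: prob_space "PiM J (\<lambda>_. ?U)" by (intro prob_space_PiM U)
  have sets_U[measurable_cong]: "sets ?U = sets borel" by simp
  have [measurable_cong]: "sets (PiM K (\<lambda>_. ?U)) = sets (PiM K (\<lambda>_. borel))" for K :: "'i set"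
    by (intro sets_PiM_cong) auto
  note [measurable] = insert.prems(1)
  define g where "g x = (\<integral>\<^sup>+y. h (x(i := y)) \<partial>?U)" for x
  have g_meas[measurable]: "g \<in> borel_measurable (PiM J (\<lambda>_. borel))"
    unfolding g_def by measurable
  have g_le: "g x \<le> ennreal H" for x
  proof -
    have "g x \<le> (\<integral>\<^sup>+y. ennreal H \<partial>?U)" unfolding g_def using insert.prems by (intro nn_integral_mono)
    then show ?thesis by (simp only: nn_integral_const prob_space.emeasure_space_1[OF U] mult_1_right)
  qed
  have split: "(\<lambda>j\<in>insert i J. (x(i := y)) j + v j) = (\<lambda>j\<in>J. x j + v j)(i := y + v i)" for x y
    using insert.hyps by (auto simp: fun_eq_iff)
  have "(\<integral>\<^sup>+x. h (\<lambda>j\<in>insert i J. x j + v j) \<partial>PiM (insert i J) (\<lambda>_. ?U)) =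
     (\<integral>\<^sup>+x. (\<integral>\<^sup>+y. h ((\<lambda>j\<in>J. x j + v j)(i := y + v i)) \<partial>?U) \<partial>PiM J (\<lambda>_. ?U))"
  proof -
    have "(\<lambda>x. h (\<lambda>j\<in>insert i J. x j + v j)) \<in> borel_measurable (PiM (insert i J) (\<lambda>_. ?U))"
      by measurable
    from product_nn_integral_insert[OF insert.hyps this] show ?thesis by (simp only: split)
  qed
  also have "\<dots> \<le> (\<integral>\<^sup>+x. g (\<lambda>j\<in>J. x j + v j) + ennreal (H * v i / L) \<partial>PiM J (\<lambda>_. ?U))"
  proof (rule nn_integral_mono)
    fix x assume "x \<in> space (PiM J (\<lambda>_. ?U))"
    have x: "(\<lambda>j\<in>J. x j + v j) \<in> space (PiM J (\<lambda>_. borel))" by (auto simp: space_PiM)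
    have "(\<lambda>y. h ((\<lambda>j\<in>J. x j + v j)(i := y))) \<in> borel_measurable borel"
      using x by measurable
    then show "(\<integral>\<^sup>+y. h ((\<lambda>j\<in>J. x j + v j)(i := y + v i)) \<partial>?U) \<le> g (\<lambda>j\<in>J. x j + v j) + ennreal (H * v i / L)"
      unfolding g_def using insert.prems by (intro nn_integral_uniform_shift L H) auto
  qed
  also have "\<dots> = (\<integral>\<^sup>+x. g (\<lambda>j\<in>J. x j + v j) \<partial>PiM J (\<lambda>_. ?U)) + ennreal (H * v i / L)"
    by (subst nn_integral_add) (auto simp: PJ.emeasure_space_1)
  also have "\<dots> \<le> (\<integral>\<^sup>+x. g x \<partial>PiM J (\<lambda>_. ?U)) + ennreal (H * (\<Sum>j\<in>J. v j) / L) + ennreal (H * v i / L)"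
    using insert.prems by (intro add_right_mono insert.IH g_meas g_le) auto
  also have "\<dots> = (\<integral>\<^sup>+x. g x \<partial>PiM J (\<lambda>_. ?U)) + ennreal (H * (\<Sum>j\<in>insert i J. v j) / L)"
    using insert.hyps insert.prems H L
    by (simp add: add.assoc sum_nonneg add_divide_distrib distrib_left flip: ennreal_plus)
  also have "(\<integral>\<^sup>+x. g x \<partial>PiM J (\<lambda>_. ?U)) = (\<integral>\<^sup>+x. h x \<partial>PiM (insert i J) (\<lambda>_. ?U))"
    unfolding g_def by (subst product_nn_integral_insert) (use insert.hyps in simp_all)
  finally show ?case .
qed

lemma gain_argmin_perm_measurable:
  assumes "\<And>j. j \<in> {1..m} \<Longrightarrow> (\<lambda>\<omega>. X \<omega> j) \<in> borel_measurable M"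
  shows "(\<lambda>\<omega>. gain m (argmin_perm m (X \<omega>)) v) \<in> borel_measurable M"
  by (rule measurable_compose[OF measurable_argmin_perm[OF assms]]) auto

section \<open>Regret of the perturbed leader on fixed payoff vectors\<close>

definition perturbation :: "nat \<Rightarrow> real \<Rightarrow> (nat \<Rightarrow> real) measure" where
  "perturbation m \<epsilon> = PiM {1..m} (\<lambda>_. uniform_upto (1 / \<epsilon>))"

definition fpl_gain :: "nat \<Rightarrow> real \<Rightarrow> (nat \<Rightarrow> real) \<Rightarrow> (nat \<Rightarrow> real) \<Rightarrow> real" where
  "fpl_gain m \<epsilon> s v = (\<integral>p. gain m (argmin_perm m (\<lambda>j. s j + p j)) v \<partial>perturbation m \<epsilon>)"

lemma prob_space_perturbation: "0 < \<epsilon> \<Longrightarrow> prob_space (perturbation m \<epsilon>)"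
  unfolding perturbation_def by (intro prob_space_PiM prob_space_uniform_upto) simp

lemma sets_perturbation: "sets (perturbation m \<epsilon>) = sets (PiM {1..m} (\<lambda>_. borel))"
  unfolding perturbation_def by (intro sets_PiM_cong) auto

lemma measurable_perturbed_gain:
  "(\<lambda>p. gain m (argmin_perm m (\<lambda>j. s j + p j)) v) \<in> borel_measurable (PiM {1..m} (\<lambda>_. borel))"
proof (rule gain_argmin_perm_measurable)
  fix j assume "j \<in> {1..m}"
  then show "(\<lambda>p. s j + p j) \<in> borel_measurable (PiM {1..m} (\<lambda>_. borel))" by measurable
qed

lemma integrable_perturbed_gain:
  assumes "0 < \<epsilon>" "\<And>i. i \<in> {1..m} \<Longrightarrow> 0 \<le> v i" "\<And>i. i \<in> {1..m} \<Longrightarrow> v i \<le> G"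
  shows "integrable (perturbation m \<epsilon>) (\<lambda>p. gain m (argmin_perm m (\<lambda>j. s j + p j)) v)"
proof -
  interpret prob_space "perturbation m \<epsilon>" using assms(1) by (rule prob_space_perturbation)
  show ?thesis
    using gain_bounds[OF assms(2,3)] measurable_perturbed_gain[of m s v]
    by (intro integrable_const_bound[of _ "real m * G"])
       (auto simp: measurable_cong_sets[OF sets_perturbation refl] abs_le_iff intro: order_trans[of _ 0])
qed

text \<open>Adding the coming payoff \<open>v\<close> to the scores is the same as shifting the
  perturbation by \<open>v\<close>, so knowing \<open>v\<close> in advance gains little. In the
  shift bound the gain is at most \<open>m * G\<close>, the interval has length
  \<open>1 / \<epsilon>\<close>, and the coordinates of \<open>v\<close> sum to at most
  \<open>m * G\<close>.\<close>

lemma fpl_gain_stable: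
  assumes \<epsilon>: "0 < \<epsilon>" and v: "\<And>i. i \<in> {1..m} \<Longrightarrow> 0 \<le> v i" "\<And>i. i \<in> {1..m} \<Longrightarrow> v i \<le> G" and G: "0 \<le> G"
  shows "fpl_gain m \<epsilon> (\<lambda>j. s j + v j) v \<le> fpl_gain m \<epsilon> s v + \<epsilon> * (real m * G)\<^sup>2"
proof -
  let ?P = "perturbation m \<epsilon>"
  let ?h = "\<lambda>p. gain m (argmin_perm m (\<lambda>j. s j + p j)) v"
  interpret prob_space ?P using \<epsilon> by (rule prob_space_perturbation)
  note gb = gain_bounds[OF v]
  have int: "integrable ?P (\<lambda>p. gain m (argmin_perm m (\<lambda>j. s' j + p j)) v)" for s'
    by (rule integrable_perturbed_gain[OF \<epsilon> v])
  have nonneg: "0 \<le> fpl_gain m \<epsilon> s' v" for s'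
    unfolding fpl_gain_def using gb(1) by (intro Bochner_Integration.integral_nonneg) auto
  have to_nn: "(\<integral>\<^sup>+p. ennreal (gain m (argmin_perm m (\<lambda>j. s' j + p j)) v) \<partial>?P) = ennreal (fpl_gain m \<epsilon> s' v)" for s'
    unfolding fpl_gain_def using gb(1) by (intro nn_integral_eq_integral int) auto
  have eq: "?h (\<lambda>j\<in>{1..m}. p j + v j) = gain m (argmin_perm m (\<lambda>j. s j + v j + p j)) v" for p
    by (intro arg_cong[of _ _ "\<lambda>\<sigma>. gain m \<sigma> v"] argmin_perm_cong) auto
  have "ennreal (fpl_gain m \<epsilon> (\<lambda>j. s j + v j) v) = (\<integral>\<^sup>+p. ennreal (?h (\<lambda>j\<in>{1..m}. p j + v j)) \<partial>?P)"
    unfolding eq by (rule to_nn[symmetric])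
  also have "\<dots> \<le> (\<integral>\<^sup>+p. ennreal (?h p) \<partial>?P) + ennreal (real m * G * (\<Sum>j\<in>{1..m}. v j) / (1 / \<epsilon>))"
    unfolding perturbation_def
  proof (rule nn_integral_PiM_uniform_shift)
    show "(\<lambda>p. ennreal (?h p)) \<in> borel_measurable (PiM {1..m} (\<lambda>_. borel))"
      using measurable_perturbed_gain by (rule measurable_compose) auto
  qed (use \<epsilon> v G gb in \<open>auto intro!: ennreal_leI\<close>)
  also have "\<dots> = ennreal (fpl_gain m \<epsilon> s v + real m * G * (\<Sum>j\<in>{1..m}. v j) * \<epsilon>)"
    unfolding to_nn using nonneg[of s] \<epsilon> G v by (subst ennreal_plus) (auto intro!: mult_nonneg_nonneg sum_nonneg)
  finally have "fpl_gain m \<epsilon> (\<lambda>j. s j + v j) v \<le> fpl_gain m \<epsilon> s v + real m * G * (\<Sum>j\<in>{1..m}. v j) * \<epsilon>"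
    using nonneg[of s] \<epsilon> G v by (subst (asm) ennreal_le_iff) (auto intro!: add_nonneg_nonneg mult_nonneg_nonneg sum_nonneg)
  also have "(\<Sum>j\<in>{1..m}. v j) \<le> (\<Sum>j\<in>{1..m}. G)" using v by (intro sum_mono) auto
  then have "real m * G * (\<Sum>j\<in>{1..m}. v j) * \<epsilon> \<le> real m * G * (real m * G) * \<epsilon>"
    using \<epsilon> G by (intro mult_right_mono mult_left_mono) auto
  finally show ?thesis by (simp add: power2_eq_square mult_ac)
qed

text \<open>The perturbation acts as the payoff of a round zero. In the induction step the leader of
  all rounds beats \<open>\<sigma>\<close>; its last payoff is split off, and on the earlier rounds
  it becomes the comparator of the induction hypothesis, which is why \<open>\<sigma>\<close> is
  generalised.\<close>

lemma be_the_perturbed_leader: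
  assumes "\<sigma> permutes {1..m}"
  shows "gain m \<sigma> (\<lambda>j. (\<Sum>k\<in>{1..<Suc K}. v k j) + p j) \<le>
    (\<Sum>b=1..K. gain m (argmin_perm m (\<lambda>j. (\<Sum>k\<in>{1..<b}. v k j) + v b j + p j)) (v b))
     + gain m (argmin_perm m p) p"
  using assms
proof (induction K arbitrary: \<sigma>)
  case 0
  then show ?case using gain_le_argmin_perm[of \<sigma> m p] by simp
next
  case (Suc K)
  let ?S = "\<lambda>j. (\<Sum>k\<in>{1..<Suc K}. v k j)"
  let ?M = "argmin_perm m (\<lambda>j. ?S j + v (Suc K) j + p j)"
  have S: "(\<Sum>k\<in>{1..<Suc (Suc K)}. v k j) = ?S j + v (Suc K) j" for j by simp
  have "gain m \<sigma> (\<lambda>j. ?S j + v (Suc K) j + p j) \<le> gain m ?M (\<lambda>j. ?S j + v (Suc K) j + p j)"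
    using Suc.prems by (rule gain_le_argmin_perm)
  also have "\<dots> = gain m ?M (\<lambda>j. ?S j + p j) + gain m ?M (v (Suc K))"
    unfolding gain_add by simp
  finally show ?case
    unfolding S using Suc.IH[OF argmin_perm_permutes, of "\<lambda>j. ?S j + v (Suc K) j + p j"] by simp
qed

text \<open>The leader that already sees the current payoff loses only what the perturbation itself
  can pay, at most \<open>m / \<epsilon>\<close>. Removing the look-ahead then costs one application
  of stability per round.\<close>

lemma fpl_regret:
  assumes \<epsilon>: "0 < \<epsilon>" and \<sigma>: "\<sigma> permutes {1..m}" and G: "0 \<le> G"
    and v: "\<And>b i. b \<in> {1..K} \<Longrightarrow> i \<in> {1..m} \<Longrightarrow> 0 \<le> v b i" "\<And>b i. b \<in> {1..K} \<Longrightarrow> i \<in> {1..m} \<Longrightarrow> v b i \<le> G"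
  shows "gain m \<sigma> (\<lambda>j. \<Sum>k\<in>{1..<Suc K}. v k j) - real m / \<epsilon> - real K * (\<epsilon> * (real m * G)\<^sup>2)
    \<le> (\<Sum>b=1..K. fpl_gain m \<epsilon> (\<lambda>j. \<Sum>k\<in>{1..<b}. v k j) (v b))"
proof -
  let ?P = "perturbation m \<epsilon>"
  interpret prob_space ?P using \<epsilon> by (rule prob_space_perturbation)
  let ?M = "\<lambda>b p. argmin_perm m (\<lambda>j. (\<Sum>k\<in>{1..<b}. v k j) + v b j + p j)"
  have AE: "AE p in ?P. \<forall>j\<in>{1..m}. 0 \<le> p j \<and> p j \<le> 1 / \<epsilon>"
  proof (rule AE_finite_allI)
    fix j assume "j \<in> {1..m}"
    then show "AE p in ?P. 0 \<le> p j \<and> p j \<le> 1 / \<epsilon>"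
      unfolding perturbation_def
      by (intro AE_PiM_component prob_space_uniform_upto AE_uniform_measureI) (use \<epsilon> in auto)
  qed simp
  have "gain m \<sigma> (\<lambda>j. \<Sum>k\<in>{1..<Suc K}. v k j) - real m / \<epsilon> \<le> (\<integral>p. (\<Sum>b=1..K. gain m (?M b p) (v b)) \<partial>?P)"
  proof (rule integral_ge_const)
    show "integrable ?P (\<lambda>p. \<Sum>b=1..K. gain m (?M b p) (v b))"
      using v \<epsilon> by (intro Bochner_Integration.integrable_sum integrable_perturbed_gain) auto
    show "AE p in ?P. gain m \<sigma> (\<lambda>j. \<Sum>k\<in>{1..<Suc K}. v k j) - real m / \<epsilon> \<le> (\<Sum>b=1..K. gain m (?M b p) (v b))"
      using AE
    proof eventually_elim
      case (elim p)
      have "0 \<le> gain m \<sigma> p" using elim by (intro gain_bounds) auto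
      moreover have "gain m (argmin_perm m p) p \<le> real m * (1 / \<epsilon>)" using elim by (intro gain_bounds) auto
      ultimately show ?case
        using be_the_perturbed_leader[OF \<sigma>, of v K p] unfolding gain_add by simp
    qed
  qed
  also have "\<dots> = (\<Sum>b=1..K. fpl_gain m \<epsilon> (\<lambda>j. (\<Sum>k\<in>{1..<b}. v k j) + v b j) (v b))"
    unfolding fpl_gain_def using v \<epsilon> by (intro Bochner_Integration.integral_sum integrable_perturbed_gain) auto
  also have "\<dots> \<le> (\<Sum>b=1..K. fpl_gain m \<epsilon> (\<lambda>j. \<Sum>k\<in>{1..<b}. v k j) (v b) + \<epsilon> * (real m * G)\<^sup>2)"
    using \<epsilon> v G by (intro sum_mono fpl_gain_stable) auto
  finally show ?thesis by (simp add: sum.distrib)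
qed

text \<open>The coefficients depend on the scores \<open>s\<close> alone. When both \<open>s\<close>
  and \<open>v\<close> are random, this reduces independence to one coordinate of \<open>v\<close>
  at a time.\<close>

lemma fpl_gain_linear:
  assumes "0 < \<epsilon>"
  shows "fpl_gain m \<epsilon> s v = (\<Sum>j=1..m. v j * fpl_gain m \<epsilon> s (\<lambda>i. of_bool (i = j)))"
proof -
  have "gain m \<sigma> v = (\<Sum>j=1..m. v j * gain m \<sigma> (\<lambda>i. of_bool (i = j)))" for \<sigma>
  proof -
    have "gain m \<sigma> (\<lambda>i. of_bool (i = j)) = 1 / log 2 (1 + real (\<sigma> j))" if "j \<in> {1..m}" for j
      unfolding gain_def using that by (subst sum.remove[of _ j]) auto
    then show ?thesis by (simp add: gain_def)
  qed
  moreover have "integrable (perturbation m \<epsilon>) (\<lambda>p. gain m (argmin_perm m (\<lambda>j. s j + p j)) (\<lambda>i. of_bool (i = j)))" for j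
    using assms by (intro integrable_perturbed_gain[of _ _ _ 1]) auto
  ultimately show ?thesis unfolding fpl_gain_def by simp
qed

section \<open>Blocks and exploration schedules\<close>

lemma block_eq_vimage:
  assumes "K dvd T" "0 < T div K" "b \<in> {1..K}"
  shows "{t\<in>{1..T}. block_of T K t = b} = block T K b"
proof -
  define B where "B = T div K"
  have T: "T = K * B" using assms by (simp add: B_def)
  have B: "0 < B" using assms by (simp add: B_def)
  have le: "b * B \<le> T" using assms T by simp
  have iff: "block_of T K t = b \<longleftrightarrow> (b - 1) * B \<le> t - 1 \<and> t - 1 < b * B" for t
  proof -
    have "block_of T K t = b \<longleftrightarrow> (t - 1) div B = b - 1"
      using assms(3) by (auto simp: block_of_def B_def)
    also have "\<dots> \<longleftrightarrow> (b - 1) * B \<le> t - 1 \<and> t - 1 < Suc (b - 1) * B"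
      unfolding less_eq_div_iff_mult_less_eq[OF B, symmetric] div_less_iff_less_mult[OF B, symmetric] by auto
    also have "Suc (b - 1) = b" using assms(3) by simp
    finally show ?thesis .
  qed
  \<comment> \<open>\<open>t - 1\<close> truncates at \<open>t = 0\<close>, so
    \<open>1 \<le> t\<close> is part of the left side; \<open>d \<le> T\<close> makes its bound by
    \<open>T\<close> automatic.\<close>
  have "1 \<le> t \<and> t \<le> T \<and> c \<le> t - 1 \<and> t - 1 < d \<longleftrightarrow> c + 1 \<le> t \<and> t \<le> d" if "d \<le> T" for c d t
    using that by linarith
  from this[OF le] show ?thesis
    unfolding block_def B_def[symmetric] iff by (simp add: set_eq_iff)
qed

lemma block_of_in:
  assumes "K dvd T" "0 < T div K" "t \<in> {1..T}"
  shows "block_of T K t \<in> {1..K}"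
proof -
  have "t - 1 < K * (T div K)" using assms by auto
  then have "(t - 1) div (T div K) < K" using assms by (subst div_less_iff_less_mult) auto
  then show ?thesis by (auto simp: block_of_def)
qed

lemma sum_blocks:
  fixes f :: "nat \<Rightarrow> real"
  assumes "K dvd T" "0 < T div K"
  shows "(\<Sum>b=1..K. \<Sum>t\<in>block T K b. f t) = (\<Sum>t=1..T. f t)"
proof -
  have "(\<Sum>b=1..K. \<Sum>t\<in>block T K b. f t) = (\<Sum>b=1..K. \<Sum>t\<in>{t\<in>{1..T}. block_of T K t = b}. f t)"
    by (intro sum.cong refl) (metis block_eq_vimage[OF assms])
  also have "\<dots> = (\<Sum>t=1..T. f t)"
    using block_of_in[OF assms] by (intro sum.group) auto
  finally show ?thesis .
qed

lemma card_block: "1 \<le> b \<Longrightarrow> card (block T K b) = T div K"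
  by (cases b) (auto simp: block_def)

section \<open>Uniform random injections into a block\<close>

text \<open>Exchanging the values \<open>t\<close> and \<open>t'\<close> after \<open>f\<close> is
  an involution that carries one set onto the other. Hence each coordinate of a uniform random
  injection is itself uniform.\<close>

lemma card_inj_funcset_component:
  fixes A :: "'a set" and B :: "'b set"
  assumes "j \<in> A" "t \<in> B" "t' \<in> B"
  shows "card {f \<in> A \<rightarrow>\<^sub>E B. inj_on f A \<and> f j = t} = card {f \<in> A \<rightarrow>\<^sub>E B. inj_on f A \<and> f j = t'}"
proof -
  define h where "h f = (\<lambda>x\<in>A. Transposition.transpose t t' (f x))" for f :: "'a \<Rightarrow> 'b"
  have inv: "h (h f) = f" if "f \<in> A \<rightarrow>\<^sub>E B" for f
    using that by (auto simp: h_def fun_eq_iff restrict_def PiE_def extensional_def)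
  have closed: "h f \<in> A \<rightarrow>\<^sub>E B" "inj_on (h f) A" if f: "f \<in> A \<rightarrow>\<^sub>E B" "inj_on f A" for f
  proof -
    have "Transposition.transpose t t' y \<in> B" if "y \<in> B" for y
      using that assms by (auto simp: Transposition.transpose_def)
    then show "h f \<in> A \<rightarrow>\<^sub>E B" using f by (auto simp: h_def)
    show "inj_on (h f) A"
      using f(2) unfolding inj_on_def restrict_def h_def by (metis transpose_involutory)
  qed
  have "h f j = Transposition.transpose t t' (f j)" for f using assms(1) by (simp add: h_def)
  then have "bij_betw h {f \<in> A \<rightarrow>\<^sub>E B. inj_on f A \<and> f j = t} {f \<in> A \<rightarrow>\<^sub>E B. inj_on f A \<and> f j = t'}"
    by (intro bij_betw_byWitness[where f' = h]) (simp_all add: inv closed image_subset_iff)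
  then show ?thesis by (rule bij_betw_same_card)
qed

lemma finite_explore_choices: "finite (explore_choices m T K b)"
  unfolding explore_choices_def
  by (rule finite_subset[of _ "{1..m} \<rightarrow>\<^sub>E block T K b"]) (auto simp: block_def intro!: finite_PiE)

lemma explore_choices_nonempty:
  assumes "m \<le> T div K" "1 \<le> b"
  shows "explore_choices m T K b \<noteq> {}"
proof -
  have "\<exists>f. f ` {1..m} \<subseteq> block T K b \<and> inj_on f {1..m}"
    using assms card_block[of b T K] by (intro card_le_inj) (auto simp: block_def)
  then obtain f where f: "f ` {1..m} \<subseteq> block T K b" "inj_on f {1..m}" by blast
  have "restrict f {1..m} \<in> {1..m} \<rightarrow>\<^sub>E block T K b"
    using f(1) unfolding restrict_PiE_iff by blast
  moreover have "inj_on (restrict f {1..m}) {1..m}" using f(2) by (simp add: inj_on_restrict_eq)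
  ultimately show ?thesis unfolding explore_choices_def by blast
qed

text \<open>The injections are grouped by their value at \<open>j\<close>. All groups have the same
  size \<open>c\<close>, so sampling without replacement still gives each single object a uniform
  time in the block.\<close>

lemma expectation_explore_choices:
  assumes "m \<le> T div K" "1 \<le> b" "j \<in> {1..m}"
  shows "measure_pmf.expectation (pmf_of_set (explore_choices m T K b)) (\<lambda>f. \<phi> (f j))
    = (\<Sum>t\<in>block T K b. \<phi> t) / real (T div K)"
proof -
  let ?F = "explore_choices m T K b" and ?B = "block T K b"
  have fin: "finite ?F" "finite ?B" by (auto simp: finite_explore_choices block_def)
  have ne: "?F \<noteq> {}" using assms by (intro explore_choices_nonempty)
  have "?B \<noteq> {}" using assms card_block[of b T K] by force
  then obtain t0 where t0: "t0 \<in> ?B" by blast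
  define c where "c = card {f\<in>?F. f j = t0}"
  have c: "card {f\<in>?F. f j = t} = c" if "t \<in> ?B" for t
    using card_inj_funcset_component[OF assms(3) that t0]
    by (simp add: c_def explore_choices_def conj_assoc)
  have sum_eq: "(\<Sum>f\<in>?F. \<psi> (f j)) = real c * (\<Sum>t\<in>?B. \<psi> t)" for \<psi> :: "nat \<Rightarrow> real"
  proof -
    have "(\<lambda>f. f j) ` ?F \<subseteq> ?B" using assms(3) by (auto simp: explore_choices_def)
    then have "(\<Sum>f\<in>?F. \<psi> (f j)) = (\<Sum>t\<in>?B. \<Sum>f\<in>{f\<in>?F. f j = t}. \<psi> (f j))"
      using fin by (intro sum.group[symmetric])
    also have "\<dots> = (\<Sum>t\<in>?B. real c * \<psi> t)"
      using c by (intro sum.cong) auto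
    finally show ?thesis by (simp add: sum_distrib_left)
  qed
  \<comment> \<open>The constant function 1 in \<open>sum_eq\<close> counts all injections.\<close>
  have card_F: "real (card ?F) = real c * real (T div K)"
    using sum_eq[of "\<lambda>_. 1"] card_block[of b T K] assms by simp
  moreover have "card ?F \<noteq> 0" using fin ne by (simp add: card_eq_0_iff)
  ultimately have "c \<noteq> 0" by (metis mult_zero_left of_nat_0 of_nat_eq_0_iff)
  with card_F show ?thesis
    using fin ne by (simp add: integral_pmf_of_set sum_eq)
qed

section \<open>Independence across blocks\<close>

text \<open>The hypothesis on \<open>\<Phi>\<close> says that it ignores coordinate
  \<open>b\<close>. Drawing that coordinate apart from all others factorises the
  expectation.\<close>

lemma expectation_Pi_pmf_indep:
  fixes \<Phi> :: "('a \<Rightarrow> 'b) \<Rightarrow> real"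
  assumes "finite A" "b \<in> A" and fin: "\<And>i. i \<in> A \<Longrightarrow> finite (set_pmf (p i))"
    and \<Phi>: "\<And>f y. \<Phi> (f(b := y)) = \<Phi> f"
  shows "measure_pmf.expectation (Pi_pmf A d p) (\<lambda>f. \<Phi> f * \<psi> (f b))
    = measure_pmf.expectation (Pi_pmf A d p) \<Phi> * measure_pmf.expectation (p b) \<psi>"
proof -
  let ?Q = "Pi_pmf (A - {b}) d p"
  have finQ: "finite (set_pmf ?Q)"
    using assms(1) fin by (subst set_Pi_pmf) (auto intro!: finite_PiE_dflt)
  have "A = insert b (A - {b})" using assms(2) by auto
  then have split: "Pi_pmf A d p = p b \<bind> (\<lambda>y. ?Q \<bind> (\<lambda>f. return_pmf (f(b := y))))"
    using Pi_pmf_insert'[of "A - {b}" b d p] assms(1) by simp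
  show ?thesis
    unfolding split using fin[OF assms(2)] finQ
    by (simp add: expectation_bind_finite \<Phi> mult.commute)
qed

lemma finite_explore_pmf:
  assumes "m \<le> T div K"
  shows "finite (set_pmf (explore_pmf m T K))"
  unfolding explore_pmf_def
  by (subst set_Pi_pmf) (auto intro!: finite_PiE_dflt simp: finite_explore_choices explore_choices_nonempty[OF assms])

lemma explore_pmf_in_block:
  assumes "m \<le> T div K" "I \<in> set_pmf (explore_pmf m T K)" "b \<in> {1..K}" "j \<in> {1..m}"
  shows "I b j \<in> block T K b"
proof -
  have "I b \<in> set_pmf (pmf_of_set (explore_choices m T K b))"
    using assms(2,3) unfolding explore_pmf_def by (subst (asm) set_Pi_pmf) (auto simp: PiE_dflt_def)
  then have "I b \<in> explore_choices m T K b"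
    using assms by (simp add: finite_explore_choices explore_choices_nonempty)
  then show ?thesis using assms(4) by (auto simp: explore_choices_def)
qed

text \<open>The estimate of block \<open>b\<close> is unbiased for the block average, even after
  multiplication by anything that the other blocks determine.\<close>

lemma expectation_rhat_indep:
  assumes "m \<le> T div K" "b \<in> {1..K}" "j \<in> {1..m}" and \<Phi>: "\<And>f y. \<Phi> (f(b := y)) = \<Phi> f"
  shows "measure_pmf.expectation (explore_pmf m T K) (\<lambda>I. \<Phi> I * rhat rs I b j)
    = measure_pmf.expectation (explore_pmf m T K) \<Phi> * ((\<Sum>t\<in>block T K b. 2 ^ rs t j - 1) / real (T div K))"
proof -
  have "measure_pmf.expectation (explore_pmf m T K) (\<lambda>I. \<Phi> I * rhat rs I b j)
     = measure_pmf.expectation (explore_pmf m T K) \<Phi> *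
        measure_pmf.expectation (pmf_of_set (explore_choices m T K b)) (\<lambda>f. 2 ^ rs (f j) j - 1)"
    unfolding explore_pmf_def rhat_def
    by (rule expectation_Pi_pmf_indep[where \<psi> = "\<lambda>f. 2 ^ rs (f j) j - 1"])
      (use assms in \<open>auto simp: finite_explore_choices explore_choices_nonempty\<close>)
  then show ?thesis
    using expectation_explore_choices[of m T K b j "\<lambda>t. 2 ^ rs t j - 1"] assms by simp
qed

section \<open>Regret of RTop-1F\<close>

lemma prob_space_perturb_measure: "0 < \<epsilon> \<Longrightarrow> prob_space (perturb_measure m T \<epsilon>)"
  unfolding perturb_measure_def by (intro prob_space_PiM prob_space_uniform_upto) simp

lemma prob_space_rtop1f_space: "0 < \<epsilon> \<Longrightarrow> prob_space (rtop1f_space m T K \<epsilon>)"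
  unfolding rtop1f_space_def
  by (intro prob_space_pair prob_space_perturb_measure measure_pmf.prob_space_axioms)

text \<open>The ranking that round \<open>t\<close> would use if it did not explore. Being defined
  for every round, it depends on the schedule only through earlier blocks.\<close>

definition perturbed_leader :: "nat \<Rightarrow> nat \<Rightarrow> nat \<Rightarrow> (nat \<Rightarrow> nat \<Rightarrow> nat) \<Rightarrow> nat \<Rightarrow>
    (nat \<Rightarrow> nat \<Rightarrow> nat) \<times> (nat \<times> nat \<Rightarrow> real) \<Rightarrow> (nat \<Rightarrow> nat)" where
  "perturbed_leader m T K rs t \<omega> =
     argmin_perm m (\<lambda>j. shat rs (fst \<omega>) (block_of T K t) j + snd \<omega> (t, j))"

lemma measurable_perturbed_leader:
  assumes "t \<in> {1..T}"
  shows "perturbed_leader m T K rs t \<in> measurable (rtop1f_space m T K \<epsilon>) (count_space UNIV)"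
  unfolding perturbed_leader_def
proof (rule measurable_argmin_perm)
  fix j assume j: "j \<in> {1..m}"
  have "(\<lambda>\<omega>. shat rs (fst \<omega>) (block_of T K t) j) \<in> borel_measurable (rtop1f_space m T K \<epsilon>)"
    unfolding rtop1f_space_def by (rule measurable_compose[OF measurable_fst]) simp
  moreover have "(\<lambda>p. p (t, j)) \<in> measurable (perturb_measure m T \<epsilon>) (uniform_upto (1 / \<epsilon>))"
    unfolding perturb_measure_def using assms j by (intro measurable_component_singleton) auto
  then have "(\<lambda>p. p (t, j)) \<in> borel_measurable (perturb_measure m T \<epsilon>)"
    by (simp cong: measurable_cong_sets)
  then have "(\<lambda>\<omega>. snd \<omega> (t, j)) \<in> borel_measurable (rtop1f_space m T K \<epsilon>)"
    unfolding rtop1f_space_def by (rule measurable_compose[OF measurable_snd])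
  ultimately show "(\<lambda>\<omega>. shat rs (fst \<omega>) (block_of T K t) j + snd \<omega> (t, j)) \<in> borel_measurable (rtop1f_space m T K \<epsilon>)"
    by (rule borel_measurable_add)
qed

lemma measurable_rtop1f_action:
  assumes "t \<in> {1..T}"
  shows "rtop1f_action m T K expl rs t \<in> measurable (rtop1f_space m T K \<epsilon>) (count_space UNIV)"
proof -
  let ?\<Omega> = "rtop1f_space m T K \<epsilon>"
  let ?Q = "\<lambda>I. \<exists>j\<in>{1..m}. I (block_of T K t) j = t"
  let ?e = "\<lambda>I. expl t (THE j. j \<in> {1..m} \<and> I (block_of T K t) j = t)"
  have "(\<lambda>\<omega>. if ?Q (fst \<omega>) then ?e (fst \<omega>) else perturbed_leader m T K rs t \<omega>)
      \<in> measurable ?\<Omega> (count_space UNIV)"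
  proof (rule measurable_If)
    show "(\<lambda>\<omega>. ?e (fst \<omega>)) \<in> measurable ?\<Omega> (count_space UNIV)"
      unfolding rtop1f_space_def by (rule measurable_compose[OF measurable_fst]) simp
    have "(\<lambda>\<omega>. ?Q (fst \<omega>)) \<in> measurable ?\<Omega> (count_space UNIV)"
      unfolding rtop1f_space_def by (rule measurable_compose[OF measurable_fst]) simp
    then show "{\<omega> \<in> space ?\<Omega>. ?Q (fst \<omega>)} \<in> sets ?\<Omega>"
      by (simp add: pred_def)
  qed (rule measurable_perturbed_leader[OF assms])
  moreover have "rtop1f_action m T K expl rs t =
      (\<lambda>\<omega>. if ?Q (fst \<omega>) then ?e (fst \<omega>) else perturbed_leader m T K rs t \<omega>)"
    by (rule ext) (simp add: rtop1f_action_def perturbed_leader_def Let_def)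
  ultimately show ?thesis by simp
qed

lemma dcg_bounds:
  assumes "\<And>i. i \<in> {1..m} \<Longrightarrow> r i \<le> n"
  shows "0 \<le> dcg m \<sigma> r" "dcg m \<sigma> r \<le> real m * (2 ^ n - 1)"
proof -
  have "(2::real) ^ r i - 1 \<le> 2 ^ n - 1" if "i \<in> {1..m}" for i
    using power_increasing[OF assms[OF that], of "2::real"] by simp
  then show "0 \<le> dcg m \<sigma> r" "dcg m \<sigma> r \<le> real m * (2 ^ n - 1)"
    unfolding dcg_eq_gain using gain_bounds[of m "\<lambda>i. 2 ^ r i - 1" "2 ^ n - 1"] by simp_all
qed

lemma integrable_dcg:
  assumes "0 < \<epsilon>" "\<And>i. i \<in> {1..m} \<Longrightarrow> r i \<le> n"
    and X: "X \<in> measurable (rtop1f_space m T K \<epsilon>) (count_space UNIV)"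
  shows "integrable (rtop1f_space m T K \<epsilon>) (\<lambda>\<omega>. dcg m (X \<omega>) r)"
proof -
  interpret prob_space "rtop1f_space m T K \<epsilon>" using assms(1) by (rule prob_space_rtop1f_space)
  have "(\<lambda>\<omega>. dcg m (X \<omega>) r) \<in> borel_measurable (rtop1f_space m T K \<epsilon>)"
    using X by (rule measurable_compose) simp
  then show ?thesis
    using dcg_bounds[where r = r and m = m and n = n, OF assms(2)]
    by (intro integrable_const_bound[of _ "real m * (2 ^ n - 1)"]) auto
qed

text \<open>No almost-sure statement is needed here: each explored round is \<open>I b j\<close> for some block \<open>b\<close>
  and object \<open>j\<close>, whether or not the schedule is injective or stays in its blocks.\<close>

lemma sum_dcg_action_ge:
  assumes "K dvd T" "0 < T div K" and rs: "\<And>t i. t \<in> {1..T} \<Longrightarrow> i \<in> {1..m} \<Longrightarrow> rs t i \<le> n"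
  shows "(\<Sum>t=1..T. dcg m (perturbed_leader m T K rs t \<omega>) (rs t)) - real K * (real m)\<^sup>2 * (2 ^ n - 1)
    \<le> (\<Sum>t=1..T. dcg m (rtop1f_action m T K expl rs t \<omega>) (rs t))"
proof -
  let ?G = "real m * (2 ^ n - 1)"
  define X where "X = {t\<in>{1..T}. \<exists>j\<in>{1..m}. fst \<omega> (block_of T K t) j = t}"
  have "X \<subseteq> (\<lambda>(b, j). fst \<omega> b j) ` ({1..K} \<times> {1..m})"
    using block_of_in[OF assms(1,2)] by (force simp: X_def)
  then have "card X \<le> card ({1..K} \<times> {1..m})" by (rule surj_card_le[rotated]) simp
  then have X: "real (card X) \<le> real K * real m"
    by (simp flip: of_nat_mult)
  have "(\<Sum>t=1..T. dcg m (perturbed_leader m T K rs t \<omega>) (rs t))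
      \<le> (\<Sum>t=1..T. dcg m (rtop1f_action m T K expl rs t \<omega>) (rs t) + ?G * of_bool (t \<in> X))"
  proof (rule sum_mono)
    fix t assume t: "t \<in> {1..T}"
    note b = dcg_bounds[where r = "rs t" and m = m and n = n, OF rs[OF t]]
    show "dcg m (perturbed_leader m T K rs t \<omega>) (rs t)
      \<le> dcg m (rtop1f_action m T K expl rs t \<omega>) (rs t) + ?G * of_bool (t \<in> X)"
    proof (cases "t \<in> X")
      case True
      then show ?thesis using b(1)[of "rtop1f_action m T K expl rs t \<omega>"] b(2)[of "perturbed_leader m T K rs t \<omega>"] by simp
    next
      case False
      then have "rtop1f_action m T K expl rs t \<omega> = perturbed_leader m T K rs t \<omega>"
        using t by (simp add: X_def rtop1f_action_def perturbed_leader_def Let_def)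
      then show ?thesis using False by simp
    qed
  qed
  also have "\<dots> = (\<Sum>t=1..T. dcg m (rtop1f_action m T K expl rs t \<omega>) (rs t)) + ?G * real (card X)"
  proof -
    have "{1..T} \<inter> {t. t \<in> X} = X" by (auto simp: X_def)
    then show ?thesis by (simp add: sum.distrib flip: sum_distrib_left)
  qed
  also have "?G * real (card X) \<le> ?G * (real K * real m)"
    using X by (intro mult_left_mono) auto
  finally show ?thesis by (simp add: power2_eq_square algebra_simps)
qed

section \<open>Averaging over perturbations and schedules\<close>

text \<open>Fubini integrates the perturbations first, for a fixed schedule. Only the coordinates of
  round \<open>t\<close> enter, so a single perturbation vector suffices.\<close>

lemma expectation_perturbed_leader:
  assumes \<epsilon>: "0 < \<epsilon>" and t: "t \<in> {1..T}" and rs: "\<And>i. i \<in> {1..m} \<Longrightarrow> r i \<le> n"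
  shows "(\<integral>\<omega>. dcg m (perturbed_leader m T K rs t \<omega>) r \<partial>rtop1f_space m T K \<epsilon>)
    = measure_pmf.expectation (explore_pmf m T K)
       (\<lambda>I. fpl_gain m \<epsilon> (shat rs I (block_of T K t)) (\<lambda>i. 2 ^ r i - 1))"
proof -
  let ?E = "measure_pmf (explore_pmf m T K)" and ?P = "perturb_measure m T \<epsilon>"
  interpret P: prob_space ?P using \<epsilon> by (rule prob_space_perturb_measure)
  interpret pair_sigma_finite ?E ?P ..
  have "(\<integral>\<omega>. dcg m (perturbed_leader m T K rs t \<omega>) r \<partial>rtop1f_space m T K \<epsilon>)
      = (\<integral>I. (\<integral>p. dcg m (perturbed_leader m T K rs t (I, p)) r \<partial>?P) \<partial>?E)"
    using integrable_dcg[OF \<epsilon> rs measurable_perturbed_leader[OF t]]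
    unfolding rtop1f_space_def by (rule integral_fst'[symmetric])
  moreover have "(\<integral>p. dcg m (perturbed_leader m T K rs t (I, p)) r \<partial>?P)
      = fpl_gain m \<epsilon> (shat rs I (block_of T K t)) (\<lambda>i. 2 ^ r i - 1)" for I
  proof -
    let ?v = "\<lambda>i. 2 ^ r i - 1 :: real" and ?s = "shat rs I (block_of T K t)"
    let ?\<pi> = "\<lambda>p. \<lambda>j\<in>{1..m}. p (t, j)"
    \<comment> \<open>Projecting the product measure along the injection
      \<open>j \<mapsto> (t, j)\<close> gives the law of one perturbation vector.\<close>
    have D: "distr ?P (perturbation m \<epsilon>) ?\<pi> = perturbation m \<epsilon>"
      unfolding perturb_measure_def perturbation_def
      by (rule distr_PiM_reindex) (use \<epsilon> t in \<open>auto simp: inj_on_def intro!: prob_space_uniform_upto\<close>)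
    have \<pi>: "?\<pi> \<in> measurable ?P (perturbation m \<epsilon>)"
      unfolding perturb_measure_def perturbation_def
      using t by (intro measurable_restrict measurable_component_singleton) auto
    have "fpl_gain m \<epsilon> ?s ?v = (\<integral>p. gain m (argmin_perm m (\<lambda>j. ?s j + p j)) ?v \<partial>distr ?P (perturbation m \<epsilon>) ?\<pi>)"
      unfolding D fpl_gain_def ..
    also have "\<dots> = (\<integral>p. gain m (argmin_perm m (\<lambda>j. ?s j + ?\<pi> p j)) ?v \<partial>?P)"
      using measurable_perturbed_gain
      by (intro integral_distr[OF \<pi>]) (simp cong: measurable_cong_sets add: sets_perturbation)
    also have "\<dots> = (\<integral>p. dcg m (perturbed_leader m T K rs t (I, p)) r \<partial>?P)"
    proof -
      have "argmin_perm m (\<lambda>j. ?s j + ?\<pi> p j) = perturbed_leader m T K rs t (I, p)" for p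
        unfolding perturbed_leader_def by (intro argmin_perm_cong) simp
      then show ?thesis by (simp only: dcg_eq_gain)
    qed
    finally show ?thesis ..
  qed
  ultimately show ?thesis by simp
qed

text \<open>The reduction to \<open>K\<close> rounds: scores are constant within a block, so by
  linearity the gains on the true relevances add up to a gain on the block average, and by
  independence the estimate may replace that average.\<close>

lemma expectation_block_fpl:
  assumes \<epsilon>: "0 < \<epsilon>" and mB: "m \<le> T div K" "0 < T div K" and b: "b \<in> {1..K}"
  shows "(\<Sum>t\<in>block T K b. measure_pmf.expectation (explore_pmf m T K)
       (\<lambda>I. fpl_gain m \<epsilon> (shat rs I b) (\<lambda>i. 2 ^ rs t i - 1)))
    = real (T div K) * measure_pmf.expectation (explore_pmf m T K) (\<lambda>I. fpl_gain m \<epsilon> (shat rs I b) (rhat rs I b))"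
proof -
  let ?E = "explore_pmf m T K"
  note [simp] = integrable_measure_pmf_finite[OF finite_explore_pmf[OF mB(1)]]
  define F where "F j I = fpl_gain m \<epsilon> (shat rs I b) (\<lambda>i. of_bool (i = j))" for j I
  have lin: "fpl_gain m \<epsilon> (shat rs I b) v = (\<Sum>j=1..m. F j I * v j)" for I v
    unfolding F_def by (subst fpl_gain_linear[OF \<epsilon>]) (simp add: mult.commute)
  \<comment> \<open>The scores used in block \<open>b\<close> sum over \<open>k < b\<close> only, so
    redrawing the schedule of block \<open>b\<close> leaves them unchanged.\<close>
  have "F j (I(b := y)) = F j I" for j I y
  proof -
    have "shat rs (I(b := y)) b = shat rs I b"
      by (auto simp: shat_def rhat_def fun_eq_iff intro!: sum.cong)
    then show ?thesis by (simp add: F_def)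
  qed
  then have ind: "measure_pmf.expectation ?E (\<lambda>I. F j I * rhat rs I b j)
    = measure_pmf.expectation ?E (F j) * ((\<Sum>t\<in>block T K b. 2 ^ rs t j - 1) / real (T div K))"
    if "j \<in> {1..m}" for j
    using that by (intro expectation_rhat_indep[OF mB(1) b])
  have "real (T div K) * measure_pmf.expectation ?E (\<lambda>I. fpl_gain m \<epsilon> (shat rs I b) (rhat rs I b))
      = (\<Sum>j=1..m. real (T div K) * measure_pmf.expectation ?E (\<lambda>I. F j I * rhat rs I b j))"
    unfolding lin by (simp add: sum_distrib_left)
  also have "\<dots> = (\<Sum>j=1..m. \<Sum>t\<in>block T K b. measure_pmf.expectation ?E (F j) * (2 ^ rs t j - 1))"
    using mB(2) by (intro sum.cong refl) (simp add: ind flip: sum_distrib_left)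
  also have "\<dots> = (\<Sum>t\<in>block T K b. \<Sum>j=1..m. measure_pmf.expectation ?E (F j) * (2 ^ rs t j - 1))"
    by (rule sum.swap)
  also have "\<dots> = (\<Sum>t\<in>block T K b. measure_pmf.expectation ?E (\<lambda>I. fpl_gain m \<epsilon> (shat rs I b) (\<lambda>i. 2 ^ rs t i - 1)))"
    unfolding lin by simp
  finally show ?thesis ..
qed

text \<open>The comparator side of the reduction: for a fixed ranking, unbiasedness alone turns
  estimated into true cumulative gain.\<close>

lemma expectation_gain_shat:
  assumes mB: "m \<le> T div K" "0 < T div K" "K dvd T"
  shows "real (T div K) * measure_pmf.expectation (explore_pmf m T K) (\<lambda>I. gain m \<sigma> (shat rs I (Suc K)))
    = (\<Sum>t=1..T. dcg m \<sigma> (rs t))"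
proof -
  let ?E = "explore_pmf m T K"
  note [simp] = integrable_measure_pmf_finite[OF finite_explore_pmf[OF mB(1)]]
  have rhat: "measure_pmf.expectation ?E (\<lambda>I. rhat rs I b j) = (\<Sum>t\<in>block T K b. 2 ^ rs t j - 1) / real (T div K)"
    if "b \<in> {1..K}" "j \<in> {1..m}" for b j
    using expectation_rhat_indep[OF mB(1) that, of "\<lambda>_. 1" rs] by simp
  have "measure_pmf.expectation ?E (\<lambda>I. gain m \<sigma> (shat rs I (Suc K)))
      = (\<Sum>j=1..m. (\<Sum>b=1..K. measure_pmf.expectation ?E (\<lambda>I. rhat rs I b j)) / log 2 (1 + real (\<sigma> j)))"
    unfolding gain_def shat_def by (simp add: atLeastLessThanSuc_atLeastAtMost)
  also have "\<dots> = (\<Sum>j=1..m. (\<Sum>b=1..K. (\<Sum>t\<in>block T K b. 2 ^ rs t j - 1) / real (T div K)) / log 2 (1 + real (\<sigma> j)))"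
    by (intro sum.cong refl arg_cong2[of _ _ _ _ "(/)"] rhat)
  also have "\<dots> = (\<Sum>j=1..m. (\<Sum>t=1..T. 2 ^ rs t j - 1) / real (T div K) / log 2 (1 + real (\<sigma> j)))"
    unfolding sum_divide_distrib[symmetric] sum_blocks[OF mB(3,2)] ..
  finally have "real (T div K) * measure_pmf.expectation ?E (\<lambda>I. gain m \<sigma> (shat rs I (Suc K)))
      = (\<Sum>j=1..m. \<Sum>t=1..T. (2 ^ rs t j - 1) / log 2 (1 + real (\<sigma> j)))"
    using mB(2) by (simp add: sum_distrib_left sum_divide_distrib)
  also have "\<dots> = (\<Sum>t=1..T. dcg m \<sigma> (rs t))"
    unfolding dcg_def by (rule sum.swap)
  finally show ?thesis .
qed

text \<open>For each fixed schedule \<open>fpl_regret\<close> applies to the sequence of block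
  estimates. Averaging over schedules and scaling by the block length replaces estimates by true
  relevances on both sides; the exploration loss is charged last.\<close>

lemma rtop1f_regret:
  assumes \<epsilon>: "0 < \<epsilon>" and mB: "m \<le> T div K" "0 < T div K" "K dvd T"
    and rs: "\<And>t i. t \<in> {1..T} \<Longrightarrow> i \<in> {1..m} \<Longrightarrow> rs t i \<le> n" and \<sigma>: "\<sigma> permutes {1..m}"
  shows "(\<Sum>t=1..T. dcg m \<sigma> (rs t)) - real (T div K) * (real m / \<epsilon>)
       - real T * (\<epsilon> * (real m * (2 ^ n - 1))\<^sup>2) - real K * (real m)\<^sup>2 * (2 ^ n - 1)
     \<le> rtop1f_expected_total m T K \<epsilon> expl rs"
proof -
  let ?E = "explore_pmf m T K" and ?\<Omega> = "rtop1f_space m T K \<epsilon>"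
  let ?G = "2 ^ n - 1 :: real"
  interpret \<Omega>: prob_space ?\<Omega> using \<epsilon> by (rule prob_space_rtop1f_space)
  note finE = finite_explore_pmf[OF mB(1)]
  note [simp] = integrable_measure_pmf_finite[OF finE]
  have "real (T div K) * (measure_pmf.expectation ?E (\<lambda>I. gain m \<sigma> (shat rs I (Suc K))) - real m / \<epsilon> - real K * (\<epsilon> * (real m * ?G)\<^sup>2))
      = real (T div K) * measure_pmf.expectation ?E (\<lambda>I. gain m \<sigma> (shat rs I (Suc K)) - real m / \<epsilon> - real K * (\<epsilon> * (real m * ?G)\<^sup>2))"
    by simp
  also have "\<dots> \<le> real (T div K) * measure_pmf.expectation ?E (\<lambda>I. \<Sum>b=1..K. fpl_gain m \<epsilon> (shat rs I b) (rhat rs I b))"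
  proof (intro mult_left_mono pmf_expectation_mono finE)
    fix I assume I: "I \<in> set_pmf ?E"
    have "0 \<le> rhat rs I b j \<and> rhat rs I b j \<le> ?G" if "b \<in> {1..K}" "j \<in> {1..m}" for b j
    proof -
      have "I b j \<in> block T K b" using I that by (intro explore_pmf_in_block[OF mB(1)])
      then have "I b j \<in> {1..T}" using block_eq_vimage[OF mB(3,2) that(1)] by auto
      then show ?thesis using rs that by (auto simp: rhat_def intro!: power_increasing)
    qed
    then show "gain m \<sigma> (shat rs I (Suc K)) - real m / \<epsilon> - real K * (\<epsilon> * (real m * ?G)\<^sup>2)
        \<le> (\<Sum>b=1..K. fpl_gain m \<epsilon> (shat rs I b) (rhat rs I b))"
      unfolding shat_def by (intro fpl_regret[OF \<epsilon> \<sigma>]) auto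
  qed simp
  also have "\<dots> = (\<Sum>b=1..K. real (T div K) * measure_pmf.expectation ?E (\<lambda>I. fpl_gain m \<epsilon> (shat rs I b) (rhat rs I b)))"
    by (simp add: sum_distrib_left)
  also have "\<dots> = (\<Sum>b=1..K. \<Sum>t\<in>block T K b. measure_pmf.expectation ?E (\<lambda>I. fpl_gain m \<epsilon> (shat rs I b) (\<lambda>i. 2 ^ rs t i - 1)))"
    by (intro sum.cong refl expectation_block_fpl[symmetric] \<epsilon> mB)
  also have "\<dots> = (\<Sum>b=1..K. \<Sum>t\<in>block T K b. measure_pmf.expectation ?E (\<lambda>I. fpl_gain m \<epsilon> (shat rs I (block_of T K t)) (\<lambda>i. 2 ^ rs t i - 1)))"
  proof (intro sum.cong refl)
    fix b t assume "b \<in> {1..K}" "t \<in> block T K b"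
    then have "block_of T K t = b" using block_eq_vimage[OF mB(3,2), of b] by auto
    then show "measure_pmf.expectation ?E (\<lambda>I. fpl_gain m \<epsilon> (shat rs I b) (\<lambda>i. 2 ^ rs t i - 1))
      = measure_pmf.expectation ?E (\<lambda>I. fpl_gain m \<epsilon> (shat rs I (block_of T K t)) (\<lambda>i. 2 ^ rs t i - 1))" by simp
  qed
  also have "\<dots> = (\<Sum>t=1..T. measure_pmf.expectation ?E (\<lambda>I. fpl_gain m \<epsilon> (shat rs I (block_of T K t)) (\<lambda>i. 2 ^ rs t i - 1)))"
    by (rule sum_blocks[OF mB(3,2)])
  also have "\<dots> = (\<Sum>t=1..T. \<integral>\<omega>. dcg m (perturbed_leader m T K rs t \<omega>) (rs t) \<partial>?\<Omega>)"
    using rs by (intro sum.cong refl expectation_perturbed_leader[symmetric] \<epsilon>) auto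
  finally have fpl: "real (T div K) * (measure_pmf.expectation ?E (\<lambda>I. gain m \<sigma> (shat rs I (Suc K))) - real m / \<epsilon> - real K * (\<epsilon> * (real m * ?G)\<^sup>2))
    \<le> (\<Sum>t=1..T. \<integral>\<omega>. dcg m (perturbed_leader m T K rs t \<omega>) (rs t) \<partial>?\<Omega>)" .
  have int: "integrable ?\<Omega> (\<lambda>\<omega>. dcg m (perturbed_leader m T K rs t \<omega>) (rs t))"
    "integrable ?\<Omega> (\<lambda>\<omega>. dcg m (rtop1f_action m T K expl rs t \<omega>) (rs t))" if "t \<in> {1..T}" for t
    using rs that by (auto intro!: integrable_dcg[where n = n] \<epsilon> measurable_perturbed_leader measurable_rtop1f_action)
  have "(\<Sum>t=1..T. \<integral>\<omega>. dcg m (perturbed_leader m T K rs t \<omega>) (rs t) \<partial>?\<Omega>) - real K * (real m)\<^sup>2 * ?G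
    = (\<integral>\<omega>. (\<Sum>t=1..T. dcg m (perturbed_leader m T K rs t \<omega>) (rs t)) - real K * (real m)\<^sup>2 * ?G \<partial>?\<Omega>)"
    using int by (subst Bochner_Integration.integral_diff)
      (auto simp: Bochner_Integration.integral_sum \<Omega>.prob_space intro!: Bochner_Integration.integrable_sum)
  also have "\<dots> \<le> rtop1f_expected_total m T K \<epsilon> expl rs"
    unfolding rtop1f_expected_total_def using int rs mB
    by (intro integral_mono Bochner_Integration.integrable_diff Bochner_Integration.integrable_sum sum_dcg_action_ge) auto
  finally have "(\<Sum>t=1..T. \<integral>\<omega>. dcg m (perturbed_leader m T K rs t \<omega>) (rs t) \<partial>?\<Omega>) - real K * (real m)\<^sup>2 * ?G
    \<le> rtop1f_expected_total m T K \<epsilon> expl rs" .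
  \<comment> \<open>Scaling by the block length turns \<open>K\<close> stability costs into
    \<open>T\<close> of them.\<close>
  moreover have "real T = real (T div K) * real K" using mB(3) by (simp flip: of_nat_mult)
  ultimately show ?thesis
    using fpl expectation_gain_shat[OF mB, of \<sigma> rs] by (simp add: right_diff_distrib mult.assoc)
qed

section \<open>Balancing the parameters\<close>

lemma best_total_attained: "\<exists>\<sigma>. \<sigma> permutes {1..m} \<and> best_total m T rs = (\<Sum>t=1..T. dcg m \<sigma> (rs t))"
proof -
  have eq: "{\<Sum>t=1..T. dcg m \<sigma> (rs t) |\<sigma>. \<sigma> permutes {1..m}} =
    (\<lambda>\<sigma>. \<Sum>t=1..T. dcg m \<sigma> (rs t)) ` {\<sigma>. \<sigma> permutes {1..m}}" by auto
  have "best_total m T rs \<in> (\<lambda>\<sigma>. \<Sum>t=1..T. dcg m \<sigma> (rs t)) ` {\<sigma>. \<sigma> permutes {1..m}}"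
    unfolding best_total_def eq using finite_permutations[of "{1..m}"] permutes_id[of "{1..m}"]
    by (intro Max_in) blast+
  then show ?thesis by auto
qed

text \<open>With the given \<open>K\<close> and \<open>\<epsilon>\<close> all three error terms
  equal \<open>?G * Z\<close>, where \<open>Z\<close> is \<open>m powr (5/3) * T powr (2/3)\<close>;
  hence the constant 3.\<close>

lemma rtop1f_upper_bound:
  assumes m: "1 \<le> m" and n: "1 \<le> n" and K: "0 < K" "K dvd T" "m \<le> T div K"
    and K_eq: "real K = real m powr (-1/3) * real T powr (2/3)"
    and \<epsilon>_eq: "\<epsilon> = sqrt (1 / ((2 ^ n - 1)\<^sup>2 * real m * real K))"
    and rs: "\<forall>t\<in>{1..T}. \<forall>i\<in>{1..m}. rs t i \<le> n"
  shows "best_total m T rs - 3 * (2 ^ n - 1) * real m powr (5/3) * real T powr (2/3)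
    \<le> rtop1f_expected_total m T K \<epsilon> expl rs"
proof -
  let ?G = "2 ^ n - 1 :: real"
  \<comment> \<open>\<open>n \<ge> 1\<close> makes \<open>?G\<close> positive; for
    \<open>?G = 0\<close> division by zero would give \<open>\<epsilon> = 0\<close>.\<close>
  have "(2::real) ^ 1 \<le> 2 ^ n" using n by (intro power_increasing) auto
  then have G: "1 \<le> ?G" by simp
  have pos: "0 < real m" "0 < real K" "0 < T" using m K by (auto intro: Nat.gr0I)
  \<comment> \<open>Since \<open>\<epsilon> = 1 / (?G * R)\<close>, the leader and stability terms
    are \<open>?G\<close> times \<open>(T / K) * m * R\<close> and \<open>T * m\<^sup>2 / R\<close>.
    These agree because \<open>R * R = m * K\<close>.\<close>
  define R where "R = sqrt (real m * real K)"
  have R: "0 < R" "R * R = real m * real K" using pos by (auto simp: R_def)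
  have \<epsilon>: "\<epsilon> = 1 / (?G * R)"
    using G by (simp add: \<epsilon>_eq R_def real_sqrt_divide real_sqrt_mult mult.assoc)
  have \<epsilon>_pos: "0 < \<epsilon>" using \<epsilon> G R by simp
  obtain \<sigma> where \<sigma>: "\<sigma> permutes {1..m}" "best_total m T rs = (\<Sum>t=1..T. dcg m \<sigma> (rs t))"
    using best_total_attained by blast
  have T: "real T = real (T div K) * real K" using K by (simp flip: of_nat_mult)
  have R_eq: "R = real m powr (1/3) * real T powr (1/3)"
  proof -
    have "R = (real m * (real m powr (-1/3) * real T powr (2/3))) powr (1/2)"
      using pos unfolding R_def K_eq by (subst powr_half_sqrt) auto
    also have "real m * (real m powr (-1/3) * real T powr (2/3)) = real m powr (2/3) * real T powr (2/3)"
      using pos powr_add[of "real m" 1 "-1/3"] by simp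
    also have "\<dots> powr (1/2) = real m powr (1/3) * real T powr (1/3)"
      by (simp add: powr_mult powr_powr)
    finally show ?thesis .
  qed
  define Z where "Z = real m powr (5/3) * real T powr (2/3)"
  have m2: "(real m)\<^sup>2 = real m powr 2" using pos by (simp add: powr_numeral)
  have t3: "real K * (real m)\<^sup>2 = Z"
    unfolding Z_def K_eq m2 using pos powr_add[of "real m" 2 "-1/3"] by (simp add: mult_ac)
  have t2: "real T * (real m)\<^sup>2 / R = Z"
  proof -
    have "Z * R = (real m powr (5/3) * real m powr (1/3)) * (real T powr (2/3) * real T powr (1/3))"
      by (simp add: Z_def R_eq mult_ac)
    also have "\<dots> = real T * (real m)\<^sup>2"
      unfolding m2 using pos by (simp flip: powr_add)
    finally show ?thesis using R by (simp add: field_simps)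
  qed
  have t1: "real (T div K) * real m * R = Z"
  proof -
    have "real (T div K) * real m * R * R = real (T div K) * real m * (real m * real K)"
      using R by (simp add: mult.assoc)
    also have "\<dots> = real T * (real m)\<^sup>2" unfolding T by (simp add: power2_eq_square mult_ac)
    finally show ?thesis using t2 R by (simp add: field_simps)
  qed
  have "real (T div K) * (real m / \<epsilon>) = ?G * Z"
    unfolding t1[symmetric] \<epsilon> by (simp add: mult_ac)
  moreover have "real T * (\<epsilon> * (real m * ?G)\<^sup>2) = ?G * Z"
    unfolding t2[symmetric] \<epsilon> using G R by (simp add: power2_eq_square field_simps)
  moreover have "real K * (real m)\<^sup>2 * ?G = ?G * Z" unfolding t3 by simp
  moreover have "3 * ?G * real m powr (5/3) * real T powr (2/3) = ?G * Z + ?G * Z + ?G * Z"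
    by (simp add: Z_def)
  moreover have "(\<Sum>t=1..T. dcg m \<sigma> (rs t)) - real (T div K) * (real m / \<epsilon>)
       - real T * (\<epsilon> * (real m * ?G)\<^sup>2) - real K * (real m)\<^sup>2 * ?G
     \<le> rtop1f_expected_total m T K \<epsilon> expl rs"
    using m K rs by (intro rtop1f_regret \<epsilon>_pos \<sigma>(1)) auto
  ultimately show ?thesis unfolding \<sigma>(2) by linarith
qed

section \<open>The lower bound\<close>

text \<open>Object 1 is always relevant; exactly one of objects 2 and 3 is, decided by a coin. The
  coin is visible exactly when object 1 is not at the top.\<close>

definition coin_rel :: "bool \<Rightarrow> nat \<Rightarrow> nat" where
  "coin_rel y i = (if i = 1 then 1 else if i = 2 then of_bool (\<not> y) else if i = 3 then of_bool y else 0)"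

text \<open>The random oblivious adversary: all coins are drawn before the game starts.\<close>

definition coin_seq :: "real \<Rightarrow> nat \<Rightarrow> (nat \<Rightarrow> nat \<Rightarrow> nat) pmf" where
  "coin_seq p T = Pi_pmf {1..T} (\<lambda>_. 0) (\<lambda>_. map_pmf coin_rel (bernoulli_pmf p))"

text \<open>The same game with each coin flipped only when its round is played, so that the history
  is built from one-step kernels.\<close>

primrec coin_play :: "learner \<Rightarrow> real \<Rightarrow> nat \<Rightarrow> ((nat \<Rightarrow> nat) \<times> nat) list pmf" where
  "coin_play L p 0 = return_pmf []"
| "coin_play L p (Suc t) = do { h \<leftarrow> coin_play L p t; \<sigma> \<leftarrow> L h; y \<leftarrow> bernoulli_pmf p;
                               return_pmf (h @ [(\<sigma>, coin_rel y (inv \<sigma> 1))]) }"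

lemma coin_rel_le_1: "coin_rel y i \<le> 1"
  by (auto simp: coin_rel_def)

section \<open>From random coins to a fixed adversary\<close>

lemma finite_set_learner:
  assumes "valid_learner m L"
  shows "finite (set_pmf (L h))"
  using assms finite_permutations[of "{1..m}"] by (auto simp: valid_learner_def intro: finite_subset)

lemma finite_set_play: "valid_learner m L \<Longrightarrow> finite (set_pmf (play L rs t))"
  by (induction t) (auto simp: finite_set_learner)

lemma finite_set_coin_play: "valid_learner m L \<Longrightarrow> finite (set_pmf (coin_play L p t))"
  by (induction t) (auto simp: finite_set_learner)

lemma length_play: "h \<in> set_pmf (play L rs t) \<Longrightarrow> length h = t"
  by (induction t arbitrary: h) auto

lemma play_cong:
  "(\<And>s. s \<in> {1..t} \<Longrightarrow> rs s = rs' s) \<Longrightarrow> play L rs t = play L rs' t"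
  by (induction t) auto

lemma finite_set_coin_seq: "finite (set_pmf (coin_seq p T))"
  unfolding coin_seq_def by (subst set_Pi_pmf) (auto intro!: finite_PiE_dflt)

lemma coin_seq_Suc:
  "coin_seq p (Suc T) = do { y \<leftarrow> bernoulli_pmf p; rs \<leftarrow> coin_seq p T;
     return_pmf (rs(Suc T := coin_rel y)) }"
proof -
  have "{1..Suc T} = insert (Suc T) {1..T}" by auto
  then show ?thesis
    unfolding coin_seq_def by (simp add: Pi_pmf_insert' bind_map_pmf)
qed

text \<open>A later coin cannot influence earlier play, so its draw can be moved behind the history
  and the ranking; independent draws commute.\<close>

lemma play_coin_seq: "coin_seq p t \<bind> (\<lambda>rs. play L rs t) = coin_play L p t"
proof (induction t)
  case 0
  then show ?case by simp
next
  case (Suc t)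
  have *: "play L (rs(Suc t := r)) t = play L rs t" for rs r
    by (rule play_cong) auto
  have "coin_seq p (Suc t) \<bind> (\<lambda>rs. play L rs (Suc t)) =
    do { y \<leftarrow> bernoulli_pmf p; rs \<leftarrow> coin_seq p t; h \<leftarrow> play L rs t; \<sigma> \<leftarrow> L h;
         return_pmf (h @ [(\<sigma>, coin_rel y (inv \<sigma> 1))]) }"
    by (simp add: coin_seq_Suc bind_assoc_pmf bind_return_pmf *)
  also have "\<dots> = do { y \<leftarrow> bernoulli_pmf p; h \<leftarrow> coin_play L p t; \<sigma> \<leftarrow> L h;
         return_pmf (h @ [(\<sigma>, coin_rel y (inv \<sigma> 1))]) }"
    unfolding Suc.IH[symmetric] bind_assoc_pmf ..
  also have "\<dots> = do { h \<leftarrow> coin_play L p t; y \<leftarrow> bernoulli_pmf p; \<sigma> \<leftarrow> L h;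
         return_pmf (h @ [(\<sigma>, coin_rel y (inv \<sigma> 1))]) }"
    by (rule bind_commute_pmf)
  also have "\<dots> = coin_play L p (Suc t)"
    by (simp add: bind_commute_pmf[of "bernoulli_pmf p"])
  finally show ?case .
qed

lemma learner_expected_total_Suc:
  assumes "valid_learner m L"
  shows "learner_expected_total m L (Suc T) rs = learner_expected_total m L T rs
    + measure_pmf.expectation (play L rs T) (\<lambda>h. measure_pmf.expectation (L h) (\<lambda>\<sigma>. dcg m \<sigma> (rs (Suc T))))"
proof -
  note fin = finite_set_play[OF assms] finite_set_learner[OF assms]
  let ?S = "\<lambda>h. \<Sum>t=1..T. dcg m (fst (h ! (t - 1))) (rs t)"
  have "learner_expected_total m L (Suc T) rs
     = measure_pmf.expectation (play L rs T) (\<lambda>h. measure_pmf.expectation (L h)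
         (\<lambda>\<sigma>. \<Sum>t=1..Suc T. dcg m (fst ((h @ [(\<sigma>, rs (Suc T) (inv \<sigma> 1))]) ! (t - 1))) (rs t)))"
    unfolding learner_expected_total_def play.simps
    by (simp add: expectation_bind_finite fin del: sum.cl_ivl_Suc)
  also have "\<dots> = measure_pmf.expectation (play L rs T) (\<lambda>h. measure_pmf.expectation (L h)
         (\<lambda>\<sigma>. ?S h + dcg m \<sigma> (rs (Suc T))))"
  proof (intro pmf_expectation_cong)
    fix h \<sigma> assume "h \<in> set_pmf (play L rs T)"
    then have l: "length h = T" by (rule length_play)
    show "(\<Sum>t=1..Suc T. dcg m (fst ((h @ [(\<sigma>, rs (Suc T) (inv \<sigma> 1))]) ! (t - 1))) (rs t))
      = ?S h + dcg m \<sigma> (rs (Suc T))"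
      by (auto simp: l nth_append intro!: sum.cong)
  qed
  also have "\<dots> = learner_expected_total m L T rs
    + measure_pmf.expectation (play L rs T) (\<lambda>h. measure_pmf.expectation (L h) (\<lambda>\<sigma>. dcg m \<sigma> (rs (Suc T))))"
    unfolding learner_expected_total_def
    by (simp add: Bochner_Integration.integral_add integrable_measure_pmf_finite fin)
  finally show ?thesis .
qed

definition coin_gain :: "real \<Rightarrow> (nat \<Rightarrow> nat) \<Rightarrow> real" where
  "coin_gain p \<sigma> = measure_pmf.expectation (bernoulli_pmf p) (\<lambda>y. dcg 3 \<sigma> (coin_rel y))"

text \<open>The coin of a round is independent of the ranking chosen in it, so each round pays
  \<open>coin_gain p\<close> on average. The induction splits off the last round, whose relevances
  the first \<open>T\<close> rounds never see.\<close>

lemma expectation_coin_seq_learner: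
  assumes "valid_learner 3 L"
  shows "measure_pmf.expectation (coin_seq p T) (learner_expected_total 3 L T)
    = (\<Sum>t<T. measure_pmf.expectation (coin_play L p t) (\<lambda>h. measure_pmf.expectation (L h) (coin_gain p)))"
proof (induction T)
  case 0
  then show ?case by (simp add: learner_expected_total_def)
next
  case (Suc T)
  note fin = finite_set_coin_seq finite_set_play[OF assms] finite_set_learner[OF assms]
  have *: "play L (rs(Suc T := r)) T = play L rs T" for rs r
    by (rule play_cong) auto
  have **: "learner_expected_total 3 L T (rs(Suc T := r)) = learner_expected_total 3 L T rs" for rs r
    unfolding learner_expected_total_def * by (intro pmf_expectation_cong sum.cong) auto
  have "measure_pmf.expectation (coin_seq p (Suc T)) (learner_expected_total 3 L (Suc T)) =
    measure_pmf.expectation (bernoulli_pmf p) (\<lambda>y. measure_pmf.expectation (coin_seq p T) (\<lambda>rs.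
      learner_expected_total 3 L T rs + measure_pmf.expectation (play L rs T) (\<lambda>h.
        measure_pmf.expectation (L h) (\<lambda>\<sigma>. dcg 3 \<sigma> (coin_rel y)))))"
    by (simp add: coin_seq_Suc expectation_bind_finite fin learner_expected_total_Suc[OF assms] * **)
  also have "\<dots> = measure_pmf.expectation (coin_seq p T) (learner_expected_total 3 L T) +
    measure_pmf.expectation (bernoulli_pmf p) (\<lambda>y. measure_pmf.expectation (coin_play L p T) (\<lambda>h.
        measure_pmf.expectation (L h) (\<lambda>\<sigma>. dcg 3 \<sigma> (coin_rel y))))"
    by (simp add: Bochner_Integration.integral_add integrable_measure_pmf_finite fin
        expectation_bind_finite flip: play_coin_seq)
  also have "measure_pmf.expectation (bernoulli_pmf p) (\<lambda>y. measure_pmf.expectation (coin_play L p T) (\<lambda>h.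
        measure_pmf.expectation (L h) (\<lambda>\<sigma>. dcg 3 \<sigma> (coin_rel y))))
     = measure_pmf.expectation (coin_play L p T) (\<lambda>h. measure_pmf.expectation (L h) (coin_gain p))"
  proof -
    \<comment> \<open>The two averages are exchanged at the level of distributions: the coin is
      commuted past history and ranking, and the pair \<open>(y, \<sigma>)\<close> keeps what the
      gain reads.\<close>
    have "measure_pmf.expectation (bernoulli_pmf p \<bind> (\<lambda>y. coin_play L p T \<bind> (\<lambda>h. L h \<bind> (\<lambda>\<sigma>. return_pmf (y,\<sigma>)))))
        (\<lambda>(y,\<sigma>). dcg 3 \<sigma> (coin_rel y)) =
      measure_pmf.expectation (coin_play L p T \<bind> (\<lambda>h. L h \<bind> (\<lambda>\<sigma>. bernoulli_pmf p \<bind> (\<lambda>y. return_pmf (y,\<sigma>)))))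
        (\<lambda>(y,\<sigma>). dcg 3 \<sigma> (coin_rel y))"
      by (subst bind_commute_pmf, subst (2) bind_commute_pmf) rule
    then show ?thesis
      by (simp add: expectation_bind_finite fin finite_set_coin_play[OF assms] coin_gain_def[abs_def])
  qed
  finally show ?case by (simp add: Suc.IH)
qed

lemma expectation_coin_seq_dcg:
  "measure_pmf.expectation (coin_seq p T) (\<lambda>rs. \<Sum>t=1..T. dcg 3 \<sigma> (rs t)) = T * coin_gain p \<sigma>"
proof -
  have "measure_pmf.expectation (coin_seq p T) (\<lambda>rs. dcg 3 \<sigma> (rs t)) = coin_gain p \<sigma>" if "t \<in> {1..T}" for t
  proof -
    have "measure_pmf.expectation (coin_seq p T) (\<lambda>rs. dcg 3 \<sigma> (rs t))
      = measure_pmf.expectation (map_pmf (\<lambda>rs. rs t) (coin_seq p T)) (dcg 3 \<sigma>)" by simp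
    also have "\<dots> = coin_gain p \<sigma>"
      using that unfolding coin_seq_def by (subst Pi_pmf_component) (auto simp: coin_gain_def)
    finally show ?thesis .
  qed
  then show ?thesis
    by (simp add: Bochner_Integration.integral_sum integrable_measure_pmf_finite finite_set_coin_seq)
qed

lemma best_total_ge:
  assumes "\<sigma> permutes {1..m}"
  shows "(\<Sum>t=1..T. dcg m \<sigma> (rs t)) \<le> best_total m T rs"
proof -
  have "{\<Sum>t=1..T. dcg m \<sigma> (rs t) |\<sigma>. \<sigma> permutes {1..m}} =
    (\<lambda>\<sigma>. \<Sum>t=1..T. dcg m \<sigma> (rs t)) ` {\<sigma>. \<sigma> permutes {1..m}}" by auto
  then show ?thesis
    unfolding best_total_def using assms finite_permutations[of "{1..m}"] by (auto intro!: Max_ge)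
qed

text \<open>The assumed gap is the mean regret against the fixed comparator \<open>\<tau>\<close>
  under random coins. Some sequence in the support does at least as badly, and the best ranking in
  hindsight dominates \<open>\<tau>\<close>.\<close>

lemma coin_adversary:
  assumes L: "valid_learner 3 L" and \<tau>: "\<tau> permutes {1..3}"
    and gap: "(\<Sum>t<T. measure_pmf.expectation (coin_play L p t)
       (\<lambda>h. measure_pmf.expectation (L h) (\<lambda>\<sigma>. coin_gain p \<tau> - coin_gain p \<sigma>))) \<ge> c"
  shows "\<exists>rs. (\<forall>t\<in>{1..T}. \<forall>i\<in>{1..3}. rs t i \<le> 1) \<and>
                  best_total 3 T rs - learner_expected_total 3 L T rs \<ge> c"
proof -
  note fin = finite_set_coin_seq finite_set_coin_play[OF L] finite_set_learner[OF L]
  have "(\<Sum>t<T. measure_pmf.expectation (coin_play L p t)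
       (\<lambda>h. measure_pmf.expectation (L h) (\<lambda>\<sigma>. coin_gain p \<tau> - coin_gain p \<sigma>)))
     = T * coin_gain p \<tau> - (\<Sum>t<T. measure_pmf.expectation (coin_play L p t) (\<lambda>h. measure_pmf.expectation (L h) (coin_gain p)))"
    by (simp add: Bochner_Integration.integral_diff integrable_measure_pmf_finite fin sum_subtractf)
  also have "\<dots> = measure_pmf.expectation (coin_seq p T)
      (\<lambda>rs. (\<Sum>t=1..T. dcg 3 \<tau> (rs t)) - learner_expected_total 3 L T rs)"
    unfolding expectation_coin_seq_learner[OF L, symmetric] expectation_coin_seq_dcg[symmetric]
    by (rule Bochner_Integration.integral_diff[symmetric]) (simp_all add: integrable_measure_pmf_finite fin)
  finally have *: "c \<le> measure_pmf.expectation (coin_seq p T)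
      (\<lambda>rs. (\<Sum>t=1..T. dcg 3 \<tau> (rs t)) - learner_expected_total 3 L T rs)" using gap by simp
  obtain rs where rs: "rs \<in> set_pmf (coin_seq p T)"
    "c \<le> (\<Sum>t=1..T. dcg 3 \<tau> (rs t)) - learner_expected_total 3 L T rs"
    using pmf_expectation_attained[OF finite_set_coin_seq] * by (meson order_trans)
  have "rs t i \<le> 1" if "t \<in> {1..T}" for t i
  proof -
    have "rs t \<in> range coin_rel"
      using rs(1) that unfolding coin_seq_def by (subst (asm) set_Pi_pmf) (auto simp: PiE_dflt_def)
    then show ?thesis using coin_rel_le_1 by auto
  qed
  moreover have "c \<le> best_total 3 T rs - learner_expected_total 3 L T rs"
    using rs(2) best_total_ge[OF \<tau>, where T = T and rs = rs] by linarith
  ultimately show ?thesis by blast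
qed

section \<open>Likelihood ratios against the fair coin\<close>

text \<open>Likelihood ratio of one round, bias \<open>1/2 + \<delta>\<close> against the fair coin.
  Object 3 on top shows the coin and object 2 its negation, so the equation between
  \<open>\<sigma> 3 = 1\<close> and \<open>x = 1\<close> decodes heads.\<close>

definition step_density :: "real \<Rightarrow> (nat \<Rightarrow> nat) \<times> nat \<Rightarrow> real" where
  "step_density \<delta> = (\<lambda>(\<sigma>, x). if \<sigma> 1 = 1 then 1
     else if (\<sigma> 3 = 1) = (x = 1) then 1 + 2 * \<delta> else 1 - 2 * \<delta>)"

definition density_ratio :: "real \<Rightarrow> ((nat \<Rightarrow> nat) \<times> nat) list \<Rightarrow> real" where
  "density_ratio \<delta> h = prod_list (map (step_density \<delta>) h)"

definition explorations :: "((nat \<Rightarrow> nat) \<times> nat) list \<Rightarrow> nat" where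
  "explorations h = length (filter (\<lambda>(\<sigma>, x). \<sigma> 1 \<noteq> 1) h)"

lemma step_density_coin:
  assumes "\<sigma> permutes {1..3}"
  shows "step_density \<delta> (\<sigma>, coin_rel y (inv \<sigma> 1)) =
    (if \<sigma> 1 = 1 then 1 else if y then 1 + 2 * \<delta> else 1 - 2 * \<delta>)"
proof (cases "\<sigma> 1 = 1")
  case False
  have inj: "inj \<sigma>" using assms by (rule permutes_inj)
  have s: "\<sigma> (inv \<sigma> 1) = 1" using assms by (rule permutes_inverses)
  have "inv \<sigma> 1 \<in> {1..3}"
    using permutes_in_image[OF permutes_inv[OF assms], of 1] by simp
  moreover have "inv \<sigma> 1 \<noteq> 1" using s False by auto
  ultimately have "inv \<sigma> 1 = 2 \<or> inv \<sigma> 1 = 3" by auto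
  moreover have "inv \<sigma> 1 = 3 \<longleftrightarrow> \<sigma> 3 = 1"
    using s inj by (metis injD)
  ultimately show ?thesis using False by (auto simp: step_density_def coin_rel_def)
qed (simp add: step_density_def)

lemma coin_rel_top:
  assumes "\<sigma> permutes {1..3}" "\<sigma> 1 = 1"
  shows "coin_rel y (inv \<sigma> 1) = 1"
proof -
  have "inv \<sigma> 1 = 1" using assms permutes_inj[OF assms(1)] by (metis inv_f_f)
  then show ?thesis by (simp add: coin_rel_def)
qed

text \<open>Change of measure, round by round. The learner draws from the same kernel under both
  biases, so only the feedback contributes a factor, and that factor is 1 when object 1 is on top
  because the feedback is then constant.\<close>

lemma expectation_coin_play_density:
  assumes L: "valid_learner 3 L" and \<delta>: "\<bar>\<delta>\<bar> \<le> 1/2"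
  shows "measure_pmf.expectation (coin_play L (1/2 + \<delta>) t) \<phi>
    = measure_pmf.expectation (coin_play L (1/2) t) (\<lambda>h. density_ratio \<delta> h * \<phi> h)"
proof (induction t arbitrary: \<phi>)
  case 0
  then show ?case by (simp add: density_ratio_def)
next
  case (Suc t)
  note fin = finite_set_coin_play[OF L] finite_set_learner[OF L]
  have step: "measure_pmf.expectation (bernoulli_pmf (1/2 + \<delta>)) (\<lambda>y. \<phi> (h @ [(\<sigma>, coin_rel y (inv \<sigma> 1))]))
    = measure_pmf.expectation (bernoulli_pmf (1/2))
       (\<lambda>y. step_density \<delta> (\<sigma>, coin_rel y (inv \<sigma> 1)) * \<phi> (h @ [(\<sigma>, coin_rel y (inv \<sigma> 1))]))"
    if "\<sigma> \<in> set_pmf (L h)" for h \<sigma>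
  proof -
    have \<sigma>: "\<sigma> permutes {1..3}" using that L by (auto simp: valid_learner_def)
    have "0 \<le> 1/2 + \<delta>" "1/2 + \<delta> \<le> 1" using \<delta> by auto
    then show ?thesis
    proof (cases "\<sigma> 1 = 1")
      case True
      with coin_rel_top[OF \<sigma>] show ?thesis by (simp add: step_density_def)
    next
      case False
      with step_density_coin[OF \<sigma>] \<open>0 \<le> 1/2 + \<delta>\<close> \<open>1/2 + \<delta> \<le> 1\<close> show ?thesis
        by (simp add: algebra_simps)
    qed
  qed
  have "measure_pmf.expectation (coin_play L (1/2 + \<delta>) (Suc t)) \<phi> =
    measure_pmf.expectation (coin_play L (1/2) t) (\<lambda>h. density_ratio \<delta> h *
      measure_pmf.expectation (L h) (\<lambda>\<sigma>. measure_pmf.expectation (bernoulli_pmf (1/2 + \<delta>))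
         (\<lambda>y. \<phi> (h @ [(\<sigma>, coin_rel y (inv \<sigma> 1))]))))"
    by (simp add: expectation_bind_finite fin Suc.IH del: integral_bernoulli_pmf)
  also have "\<dots> = measure_pmf.expectation (coin_play L (1/2) t) (\<lambda>h. density_ratio \<delta> h *
      measure_pmf.expectation (L h) (\<lambda>\<sigma>. measure_pmf.expectation (bernoulli_pmf (1/2))
         (\<lambda>y. step_density \<delta> (\<sigma>, coin_rel y (inv \<sigma> 1)) * \<phi> (h @ [(\<sigma>, coin_rel y (inv \<sigma> 1))]))))"
    by (intro pmf_expectation_cong arg_cong2[of _ _ _ _ "(*)"] refl step)
  also have "\<dots> = measure_pmf.expectation (coin_play L (1/2) (Suc t)) (\<lambda>h. density_ratio \<delta> h * \<phi> h)"
    by (simp add: expectation_bind_finite fin density_ratio_def mult.assoc del: integral_bernoulli_pmf)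
  finally show ?case .
qed

lemma density_ratio_nonneg: "\<bar>\<delta>\<bar> \<le> 1/2 \<Longrightarrow> 0 \<le> density_ratio \<delta> h"
  by (induction h) (auto simp: density_ratio_def step_density_def split: prod.splits)

text \<open>Whichever way the coin falls, an exploring round puts \<open>1 + 2 * \<delta>\<close>
  into one ratio and \<open>1 - 2 * \<delta>\<close> into the other.\<close>

lemma density_ratio_mult:
  "density_ratio \<delta> h * density_ratio (-\<delta>) h = (1 - 4 * \<delta>\<^sup>2) ^ explorations h"
proof (induction h)
  case (Cons a h)
  obtain \<sigma> x where a: "a = (\<sigma>, x)" by force
  have *: "density_ratio d (a # h) = step_density d a * density_ratio d h" for d
    by (simp add: density_ratio_def)
  have s: "step_density \<delta> a * step_density (-\<delta>) a = (if \<sigma> 1 = 1 then 1 else 1 - 4 * \<delta>\<^sup>2)"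
    by (simp add: a step_density_def power2_eq_square algebra_simps)
  have "density_ratio \<delta> (a # h) * density_ratio (-\<delta>) (a # h)
      = (step_density \<delta> a * step_density (-\<delta>) a) * (density_ratio \<delta> h * density_ratio (-\<delta>) h)"
    by (simp add: * mult_ac)
  then show ?case unfolding s Cons.IH by (simp add: a explorations_def)
qed (simp add: density_ratio_def explorations_def)

text \<open>Expresses the exploration count through per-round probabilities, the form in which it
  can be charged as regret.\<close>

lemma expectation_explorations:
  assumes L: "valid_learner 3 L"
  shows "measure_pmf.expectation (coin_play L p t) (\<lambda>h. real (explorations h))
    = (\<Sum>s<t. measure_pmf.expectation (coin_play L p s) (\<lambda>h. measure_pmf.expectation (L h) (\<lambda>\<sigma>. of_bool (\<sigma> 1 \<noteq> 1))))"
proof (induction t)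
  case (Suc t)
  note fin = finite_set_coin_play[OF L] finite_set_learner[OF L]
  have "real (explorations (h @ [(\<sigma>, x)])) = real (explorations h) + of_bool (\<sigma> 1 \<noteq> 1)" for h \<sigma> x
    by (simp add: explorations_def)
  then show ?case
    by (simp add: expectation_bind_finite fin Bochner_Integration.integral_add
        integrable_measure_pmf_finite Suc.IH del: integral_bernoulli_pmf)
qed (simp add: explorations_def)

text \<open>The product of the two likelihood ratios depends only on the number of explorations, so the
  Hellinger affinity is controlled by their expectation under the fair coin alone. No conversion
  to total variation is needed: pointwise \<open>min d d' \<ge> sqrt (d d') - (d + d') / 4\<close>.\<close>

lemma two_point_bound:
  fixes A :: "((nat \<Rightarrow> nat) \<times> nat) list \<Rightarrow> real"
  assumes L: "valid_learner 3 L" and \<delta>: "\<bar>\<delta>\<bar> \<le> 1/4" and A: "\<And>h. 0 \<le> A h" "\<And>h. A h \<le> 1"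
  shows "measure_pmf.expectation (coin_play L (1/2 + \<delta>) t) A
       + measure_pmf.expectation (coin_play L (1/2 - \<delta>) t) (\<lambda>h. 1 - A h)
     \<ge> 1/2 - 4 * \<delta>\<^sup>2 * measure_pmf.expectation (coin_play L (1/2) t) (\<lambda>h. real (explorations h))"
proof -
  note fin = finite_set_coin_play[OF L]
  note [simp] = integrable_measure_pmf_finite[OF fin]
  let ?P = "coin_play L (1/2) t"
  let ?d = "density_ratio \<delta>" and ?d' = "density_ratio (-\<delta>)"
  \<comment> \<open>Both ratios are densities, so subtracting a quarter of their sum costs exactly
    \<open>1/2\<close> on average.\<close>
  have "measure_pmf.expectation ?P ?d = 1"
    using expectation_coin_play_density[OF L, of \<delta> t "\<lambda>_. 1"] \<delta> by simp
  moreover have "measure_pmf.expectation ?P ?d' = 1"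
    using expectation_coin_play_density[OF L, of "-\<delta>" t "\<lambda>_. 1"] \<delta> by simp
  ultimately have "1/2 - 4 * \<delta>\<^sup>2 * measure_pmf.expectation ?P (\<lambda>h. real (explorations h))
     = measure_pmf.expectation ?P (\<lambda>h. 1 - 4 * \<delta>\<^sup>2 * real (explorations h) - (?d h + ?d' h) / 4)"
    by simp
  also have "\<dots> \<le> measure_pmf.expectation ?P (\<lambda>h. ?d h * A h + ?d' h * (1 - A h))"
  proof (rule pmf_expectation_mono[OF fin])
    fix h
    define x where "x = 4 * \<delta>\<^sup>2"
    define q where "q = sqrt (1 - x) ^ explorations h"
    have "\<delta>\<^sup>2 \<le> (1/4)\<^sup>2" using \<delta> by (metis abs_ge_zero power2_abs power_mono)
    then have x: "0 \<le> x" "x \<le> 1" by (auto simp: x_def power2_eq_square)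
    have nonneg: "0 \<le> ?d h" "0 \<le> ?d' h" using \<delta> by (auto intro!: density_ratio_nonneg)
    \<comment> \<open>Together with Bernoulli's inequality this bounds the affinity \<open>q\<close>
      below linearly in the number of explorations.\<close>
    have "1 - x \<le> sqrt (1 - x)" using x by (intro real_le_rsqrt) (auto simp: power2_eq_square intro: mult_left_le)
    then have "1 - real (explorations h) * x \<le> 1 + real (explorations h) * (sqrt (1 - x) - 1)"
      using mult_left_mono[of "1 - x" "sqrt (1-x)" "real (explorations h)"] by (simp add: algebra_simps)
    also have "\<dots> \<le> q"
      using Bernoulli_inequality[of "sqrt (1 - x) - 1" "explorations h"] x by (simp add: q_def)
    finally have q: "1 - real (explorations h) * x \<le> q" .
    have q2: "q\<^sup>2 = ?d h * ?d' h"
    proof -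
      have "q\<^sup>2 = (sqrt (1 - x))\<^sup>2 ^ explorations h"
        by (simp only: q_def power_mult[symmetric] mult.commute)
      then show ?thesis using x by (simp add: density_ratio_mult x_def)
    qed
    \<comment> \<open>Arithmetic-geometric mean, as \<open>q\<^sup>2\<close> is four times the
      product of the two summands. With the mirrored inequality below, \<open>q\<close> minus a
      quarter of the sum is at most three quarters of either ratio.\<close>
    have "q \<le> ?d h / 4 + ?d' h"
    proof (rule power2_le_imp_le)
      have "(?d h / 4 + ?d' h)\<^sup>2 - q\<^sup>2 = (?d h / 4 - ?d' h)\<^sup>2"
        unfolding q2 by (simp add: power2_eq_square algebra_simps)
      then show "q\<^sup>2 \<le> (?d h / 4 + ?d' h)\<^sup>2" by (smt (verit) zero_le_power2)
    qed (use nonneg in auto)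
    moreover have "q \<le> ?d h + ?d' h / 4"
    proof (rule power2_le_imp_le)
      have "(?d h + ?d' h / 4)\<^sup>2 - q\<^sup>2 = (?d h - ?d' h / 4)\<^sup>2"
        unfolding q2 by (simp add: power2_eq_square algebra_simps)
      then show "q\<^sup>2 \<le> (?d h + ?d' h / 4)\<^sup>2" by (smt (verit) zero_le_power2)
    qed (use nonneg in auto)
    ultimately have "q - (?d h + ?d' h) / 4 \<le> min (?d h) (?d' h)"
      using nonneg by (auto simp: min_def field_simps)
    \<comment> \<open>\<open>A h\<close> and \<open>1 - A h\<close> are the error weights of a
      randomised test between the two biases; any such test pays at least the minimum.\<close>
    also have "\<dots> = min (?d h) (?d' h) * A h + min (?d h) (?d' h) * (1 - A h)" by (simp add: algebra_simps)
    also have "\<dots> \<le> ?d h * A h + ?d' h * (1 - A h)"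
      using A[of h] by (intro add_mono mult_right_mono) auto
    finally show "1 - 4 * \<delta>\<^sup>2 * real (explorations h) - (?d h + ?d' h) / 4 \<le> ?d h * A h + ?d' h * (1 - A h)"
      using q by (simp add: x_def mult_ac)
  qed
  also have "\<dots> = measure_pmf.expectation (coin_play L (1/2 + \<delta>) t) A
       + measure_pmf.expectation (coin_play L (1/2 - \<delta>) t) (\<lambda>h. 1 - A h)"
    using expectation_coin_play_density[OF L, of \<delta> t A]
      expectation_coin_play_density[OF L, of "-\<delta>" t "\<lambda>h. 1 - A h"] \<delta> by simp
  finally show ?thesis .
qed

section \<open>Cost of a wrong ranking in one round\<close>

lemma coin_gain_eq:
  assumes "0 \<le> p" "p \<le> 1"
  shows "coin_gain p \<sigma> = 1 / log 2 (1 + real (\<sigma> 1)) + p / log 2 (1 + real (\<sigma> 3))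
    + (1 - p) / log 2 (1 + real (\<sigma> 2))"
proof -
  have "{1..3::nat} = {1,2,3}" by auto
  then show ?thesis using assms by (simp add: coin_gain_def dcg_def coin_rel_def algebra_simps add_divide_distrib diff_divide_distrib)
qed

lemma permutes_3_cases:
  assumes "\<sigma> permutes {1..3::nat}"
  shows "(\<sigma> 1, \<sigma> 2, \<sigma> 3) \<in> {(1,2,3),(1,3,2),(2,1,3),(2,3,1),(3,1,2),(3,2,1)}"
proof -
  have eq: "{1..3} = {1, 2, 3::nat}" by auto
  have "\<sigma> 1 \<in> {1, 2, 3}" "\<sigma> 2 \<in> {1, 2, 3}" "\<sigma> 3 \<in> {1, 2, 3}"
    unfolding eq[symmetric] permutes_in_image[OF assms] by simp_all
  moreover have "\<sigma> 1 \<noteq> \<sigma> 2" "\<sigma> 1 \<noteq> \<sigma> 3" "\<sigma> 2 \<noteq> \<sigma> 3"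
    using permutes_inj[OF assms] by (simp_all add: inj_eq)
  ultimately show ?thesis by (elim insertE emptyE) simp_all
qed

text \<open>The discount of rank 2; ranks 1 and 3 have discounts 1 and \<open>1/2\<close>.\<close>

abbreviation (input) "log3_inv \<equiv> 1 / log 2 3 :: real"

lemma log3_inv_bounds: "1/2 < log3_inv" "log3_inv < 1"
proof -
  have "log 2 3 < log 2 (2^2 :: real)" by (subst log_less_cancel_iff) auto
  then have "log 2 3 < (2::real)" by (subst (asm) log_pow_cancel) auto
  moreover have "log 2 2 < log 2 (3::real)" by (subst log_less_cancel_iff) auto
  then have "1 < log 2 (3::real)" by simp
  ultimately show "1/2 < log3_inv" "log3_inv < 1" by (auto simp: field_simps)
qed

lemma log_2_4: "log 2 4 = (2::real)"
  using log_pow_cancel[of 2 2] by simp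

text \<open>Under the fair coin objects 2 and 3 are both worth \<open>1/2\<close>. The cheapest way
  to explore swaps object 1 with the object at rank 2, at cost
  \<open>(1 - log3_inv) * (1 - 1/2)\<close>.\<close>

lemma gap_fair:
  assumes "\<sigma> permutes {1..3}"
  shows "(1 - log3_inv) / 2 * of_bool (\<sigma> 1 \<noteq> 1) \<le> coin_gain (1/2) id - coin_gain (1/2) \<sigma>"
proof -
  define \<beta> where "\<beta> = log3_inv"
  have \<beta>: "1/2 < \<beta>" "\<beta> < 1" using log3_inv_bounds by (auto simp: \<beta>_def)
  have 1: "x / log 2 3 = x * \<beta>" "1 / (2 * log 2 3) = \<beta> / 2" for x by (simp_all add: \<beta>_def)
  show ?thesis
    using permutes_3_cases[OF assms(1)] \<beta>
    by (auto simp: coin_gain_eq log_2_4 1 algebra_simps add_divide_distrib diff_divide_distrib)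
qed

text \<open>Object 3 is now likelier by \<open>2 * \<delta>\<close>, so the best order is 1, 3, 2.
  Keeping object 1 on top but placing 2 before 3 loses that difference times the discount step from
  rank 2 to rank 3; \<open>\<delta> \<le> 1/4\<close> keeps every other misordering at least as
  costly.\<close>

lemma gap_up:
  assumes "\<sigma> permutes {1..3}" "0 \<le> \<delta>" "\<delta> \<le> 1/4"
  shows "2 * \<delta> * (log3_inv - 1/2) * of_bool (\<sigma> 2 < \<sigma> 3)
    \<le> coin_gain (1/2 + \<delta>) (Transposition.transpose 2 3) - coin_gain (1/2 + \<delta>) \<sigma>"
proof -
  define \<beta> where "\<beta> = log3_inv"
  have \<beta>: "1/2 < \<beta>" "\<beta> < 1" using log3_inv_bounds by (auto simp: \<beta>_def)
  have 1: "x / log 2 3 = x * \<beta>" "1 / (2 * log 2 3) = \<beta> / 2" for x by (simp_all add: \<beta>_def)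
  \<comment> \<open>These products let linear arithmetic settle the six rankings with
    \<open>\<delta> * \<beta>\<close> treated as an atom.\<close>
  have "0 \<le> \<delta> * (1 - \<beta>)" "0 \<le> \<delta> * (\<beta> - 1/2)" "0 \<le> (1/4 - \<delta>) * (1 - \<beta>)" using \<beta> assms by auto
  then show ?thesis
    using permutes_3_cases[OF assms(1)] \<beta> assms(2,3)
    by (auto simp: coin_gain_eq log_2_4 1 Transposition.transpose_def algebra_simps add_divide_distrib diff_divide_distrib)
qed

text \<open>Mirror image of \<open>gap_up\<close>, with objects 2 and 3 exchanged.\<close>

lemma gap_down:
  assumes "\<sigma> permutes {1..3}" "0 \<le> \<delta>" "\<delta> \<le> 1/4"
  shows "2 * \<delta> * (log3_inv - 1/2) * (1 - of_bool (\<sigma> 2 < \<sigma> 3))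
    \<le> coin_gain (1/2 - \<delta>) id - coin_gain (1/2 - \<delta>) \<sigma>"
proof -
  define \<beta> where "\<beta> = log3_inv"
  have \<beta>: "1/2 < \<beta>" "\<beta> < 1" using log3_inv_bounds by (auto simp: \<beta>_def)
  have 1: "x / log 2 3 = x * \<beta>" "1 / (2 * log 2 3) = \<beta> / 2" for x by (simp_all add: \<beta>_def)
  have "0 \<le> \<delta> * (1 - \<beta>)" "0 \<le> \<delta> * (\<beta> - 1/2)" "0 \<le> (1/4 - \<delta>) * (1 - \<beta>)" using \<beta> assms by auto
  then show ?thesis
    using permutes_3_cases[OF assms(1)] \<beta> assms(2,3)
    by (auto simp: coin_gain_eq log_2_4 1 Transposition.transpose_def algebra_simps add_divide_distrib diff_divide_distrib)
qed

section \<open>The dichotomy between exploring and not distinguishing\<close>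

lemma dcg_top1_lower_bound:
  "\<exists>c>0. \<exists>T0. \<forall>T\<ge>T0. \<forall>L. valid_learner 3 L \<longrightarrow>
     (\<exists>rs. (\<forall>t\<in>{1..T}. \<forall>i\<in>{1..3}. rs t i \<le> 1) \<and>
           best_total 3 T rs - learner_expected_total 3 L T rs \<ge> c * real T powr (2/3))"
proof -
  define \<kappa> :: real where "\<kappa> = (1 - log3_inv) / 2"
  define \<gamma> :: real where "\<gamma> = log3_inv - 1/2"
  \<comment> \<open>\<open>\<kappa>\<close> is the cost per exploration. In the other case the two
    regrets sum to at least \<open>\<gamma> / 8 * T powr (2/3)\<close>, so one of them reaches half
    of that.\<close>
  define c where "c = min \<kappa> (\<gamma> / 16)"
  have pos: "0 < \<kappa>" "0 < \<gamma>" using log3_inv_bounds by (auto simp: \<kappa>_def \<gamma>_def)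
  have main: "\<exists>rs. (\<forall>t\<in>{1..T}. \<forall>i\<in>{1..3}. rs t i \<le> 1) \<and>
           best_total 3 T rs - learner_expected_total 3 L T rs \<ge> c * real T powr (2/3)"
    if T: "T \<ge> 1" and L: "valid_learner 3 L" for T L
  proof -
    note fin = finite_set_coin_play[OF L] finite_set_learner[OF L]
    note [simp] = integrable_measure_pmf_finite[OF fin(1)] integrable_measure_pmf_finite[OF fin(2)]
    have perm: "\<sigma> permutes {1..3}" if "\<sigma> \<in> set_pmf (L h)" for \<sigma> h
      using that L by (auto simp: valid_learner_def)
    define E where "E p t \<phi> = measure_pmf.expectation (coin_play L p t)
       (\<lambda>h. measure_pmf.expectation (L h) \<phi>)" for p t and \<phi> :: "(nat \<Rightarrow> nat) \<Rightarrow> real"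
    have E_mono: "E p t f \<le> E p t g" if "\<And>\<sigma>. \<sigma> permutes {1..3} \<Longrightarrow> f \<sigma> \<le> g \<sigma>" for p t f g
      unfolding E_def using that perm by (intro pmf_expectation_mono fin) auto
    have E_cmult: "E p t (\<lambda>\<sigma>. a * f \<sigma>) = a * E p t f" for p t a f
      unfolding E_def by simp
    have adv: ?thesis if "\<tau> permutes {1..3}"
      "c * real T powr (2/3) \<le> (\<Sum>t<T. E p t (\<lambda>\<sigma>. coin_gain p \<tau> - coin_gain p \<sigma>))" for \<tau> p
      using coin_adversary[OF L that(1), of "c * real T powr (2/3)" p T] that(2) unfolding E_def by blast
    define N where "N t = measure_pmf.expectation (coin_play L (1/2) t) (\<lambda>h. real (explorations h))" for t
    have N: "N t = (\<Sum>s<t. E (1/2) s (\<lambda>\<sigma>. of_bool (\<sigma> 1 \<noteq> 1)))" for t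
      unfolding N_def E_def by (rule expectation_explorations[OF L])
    have E_nonneg: "0 \<le> E p t (\<lambda>\<sigma>. of_bool (P \<sigma>))" for p t P
      unfolding E_def by (intro Bochner_Integration.integral_nonneg) auto
    \<comment> \<open>Explorations accumulate, so the bound at time \<open>T\<close> controls every
      round and a single \<open>\<delta>\<close> serves them all.\<close>
    have N_mono: "N t \<le> N T" if "t < T" for t
      unfolding N using that E_nonneg by (intro sum_mono2) auto
    show ?thesis
    proof (cases "N T \<ge> real T powr (2/3)")
      case True
      have "c * real T powr (2/3) \<le> \<kappa> * N T"
        using True pos by (intro mult_mono) (auto simp: c_def)
      also have "\<dots> = (\<Sum>t<T. E (1/2) t (\<lambda>\<sigma>. \<kappa> * of_bool (\<sigma> 1 \<noteq> 1)))"
        unfolding N by (simp add: E_cmult sum_distrib_left)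
      also have "\<dots> \<le> (\<Sum>t<T. E (1/2) t (\<lambda>\<sigma>. coin_gain (1/2) id - coin_gain (1/2) \<sigma>))"
        using gap_fair unfolding \<kappa>_def by (intro sum_mono E_mono) auto
      finally show ?thesis by (intro adv[of id "1/2"]) (auto simp: permutes_id)
    next
      case False
      \<comment> \<open>Chosen so that \<open>4 * \<delta>\<^sup>2 * T powr (2/3) = 1/4\<close>,
        which leaves \<open>1/4\<close> of the \<open>1/2\<close> in
        \<open>two_point_bound\<close>.\<close>
      define \<delta> where "\<delta> = real T powr (-1/3) / 4"
      have "real T powr (-1/3) \<le> 1" using T powr_mono[of "-1/3" 0 "real T"] by simp
      then have \<delta>: "0 \<le> \<delta>" "\<delta> \<le> 1/4" by (auto simp: \<delta>_def)
      have "4 * \<delta>\<^sup>2 * N T \<le> 4 * \<delta>\<^sup>2 * real T powr (2/3)"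
        using False by (intro mult_left_mono) auto
      also have "\<dots> = 1/4"
        using T by (simp add: \<delta>_def power2_eq_square flip: powr_add)
      finally have small: "4 * \<delta>\<^sup>2 * N T \<le> 1/4" .
      define up where "up t = E (1/2 + \<delta>) t (\<lambda>\<sigma>. coin_gain (1/2 + \<delta>) (Transposition.transpose 2 3) - coin_gain (1/2 + \<delta>) \<sigma>)" for t
      define dn where "dn t = E (1/2 - \<delta>) t (\<lambda>\<sigma>. coin_gain (1/2 - \<delta>) id - coin_gain (1/2 - \<delta>) \<sigma>)" for t
      have "\<delta> * \<gamma> / 2 \<le> up t + dn t" if "t < T" for t
      proof -
        \<comment> \<open>The test read off the learner: the probability of ranking object 2 before
          object 3, which is the error when object 3 is likelier.\<close>
        define A where "A h = measure_pmf.expectation (L h) (\<lambda>\<sigma>. of_bool (\<sigma> 2 < \<sigma> 3) :: real)" for h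
        have A: "0 \<le> A h" "A h \<le> 1" for h
          unfolding A_def by (auto intro!: Bochner_Integration.integral_nonneg measure_pmf.integral_le_const)
        have "4 * \<delta>\<^sup>2 * N t \<le> 4 * \<delta>\<^sup>2 * N T"
          using N_mono[OF that] by (intro mult_left_mono) auto
        then have "1/4 \<le> 1/2 - 4 * \<delta>\<^sup>2 * N t" using small by simp
        also have "\<dots> \<le> measure_pmf.expectation (coin_play L (1/2 + \<delta>) t) A
            + measure_pmf.expectation (coin_play L (1/2 - \<delta>) t) (\<lambda>h. 1 - A h)"
          unfolding N_def using \<delta> by (intro two_point_bound[OF L _ A]) auto
        also have "\<dots> = E (1/2 + \<delta>) t (\<lambda>\<sigma>. of_bool (\<sigma> 2 < \<sigma> 3)) + E (1/2 - \<delta>) t (\<lambda>\<sigma>. 1 - of_bool (\<sigma> 2 < \<sigma> 3))"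
          unfolding E_def A_def by simp
        finally have "2 * \<delta> * \<gamma> * (1/4) \<le> 2 * \<delta> * \<gamma> * \<dots>"
          using pos \<delta> by (intro mult_left_mono) auto
        also have "\<dots> = E (1/2 + \<delta>) t (\<lambda>\<sigma>. 2 * \<delta> * \<gamma> * of_bool (\<sigma> 2 < \<sigma> 3))
            + E (1/2 - \<delta>) t (\<lambda>\<sigma>. 2 * \<delta> * \<gamma> * (1 - of_bool (\<sigma> 2 < \<sigma> 3)))"
          unfolding E_cmult by (simp add: algebra_simps)
        also have "\<dots> \<le> up t + dn t"
          unfolding up_def dn_def \<gamma>_def using gap_up gap_down \<delta> by (intro add_mono E_mono) auto
        finally show ?thesis by simp
      qed
      then have "(\<Sum>t<T. \<delta> * \<gamma> / 2) \<le> (\<Sum>t<T. up t + dn t)" by (intro sum_mono) auto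
      then have "real T * \<delta> * \<gamma> / 2 \<le> (\<Sum>t<T. up t) + (\<Sum>t<T. dn t)" by (simp add: sum.distrib)
      moreover have "real T * \<delta> = real T powr (2/3) / 4"
        using T powr_add[of "real T" 1 "-1/3"] by (simp add: \<delta>_def)
      ultimately have "\<gamma> / 16 * real T powr (2/3) \<le> (\<Sum>t<T. up t) \<or> \<gamma> / 16 * real T powr (2/3) \<le> (\<Sum>t<T. dn t)"
        unfolding mult.commute[of _ \<gamma>] by (auto simp: mult.assoc)
      moreover have "c * real T powr (2/3) \<le> \<gamma> / 16 * real T powr (2/3)"
        by (intro mult_right_mono) (auto simp: c_def)
      ultimately consider "c * real T powr (2/3) \<le> (\<Sum>t<T. up t)" | "c * real T powr (2/3) \<le> (\<Sum>t<T. dn t)"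
        by linarith
      then show ?thesis
      proof cases
        case 1
        then show ?thesis unfolding up_def by (intro adv[of "Transposition.transpose 2 3"]) (auto intro: permutes_swap_id)
      next
        case 2
        then show ?thesis unfolding dn_def by (intro adv[of id]) (auto simp: permutes_id)
      qed
    qed
  qed
  have "c > 0" using pos by (simp add: c_def)
  then show ?thesis using main by blast
qed

theorem theorem4:
  shows "(\<exists>C>0. \<forall>m n T K \<epsilon> expl rs.
            m \<ge> 1 \<longrightarrow> n \<ge> 1 \<longrightarrow> K > 0 \<longrightarrow> K dvd T \<longrightarrow> m \<le> T div K \<longrightarrow>
            real K = real m powr (-1/3) * real T powr (2/3) \<longrightarrow>
            \<epsilon> = sqrt (1 / ((2 ^ n - 1)\<^sup>2 * real m * real K)) \<longrightarrow>
            (\<forall>t j. j \<in> {1..m} \<longrightarrow> expl t j permutes {1..m} \<and> expl t j j = 1) \<longrightarrow>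
            (\<forall>t\<in>{1..T}. \<forall>i\<in>{1..m}. rs t i \<le> n) \<longrightarrow>
            rtop1f_expected_total m T K \<epsilon> expl rs
              \<ge> best_total m T rs - C * (2 ^ n - 1) * real m powr (5/3) * real T powr (2/3))
       \<and> (\<exists>C>0. \<forall>m T K \<epsilon> expl rs.
            m \<ge> 1 \<longrightarrow> K > 0 \<longrightarrow> K dvd T \<longrightarrow> m \<le> T div K \<longrightarrow>
            real K = real m powr (-1/3) * real T powr (2/3) \<longrightarrow>
            \<epsilon> = sqrt (1 / ((2 ^ 1 - 1)\<^sup>2 * real m * real K)) \<longrightarrow>
            (\<forall>t j. j \<in> {1..m} \<longrightarrow> expl t j permutes {1..m} \<and> expl t j j = 1) \<longrightarrow>
            (\<forall>t\<in>{1..T}. \<forall>i\<in>{1..m}. rs t i \<le> 1) \<longrightarrow>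
            rtop1f_expected_total m T K \<epsilon> expl rs
              \<ge> best_total m T rs - C * real m powr (5/3) * real T powr (2/3))
       \<and> (\<exists>c>0. \<exists>T0. \<forall>T\<ge>T0. \<forall>L. valid_learner 3 L \<longrightarrow>
            (\<exists>rs. (\<forall>t\<in>{1..T}. \<forall>i\<in>{1..3}. rs t i \<le> 1) \<and>
                  best_total 3 T rs - learner_expected_total 3 L T rs \<ge> c * real T powr (2/3)))"
proof (intro conjI)
  show "(\<exists>C>0. \<forall>m n T K \<epsilon> expl rs.
            m \<ge> 1 \<longrightarrow> n \<ge> 1 \<longrightarrow> K > 0 \<longrightarrow> K dvd T \<longrightarrow> m \<le> T div K \<longrightarrow>
            real K = real m powr (-1/3) * real T powr (2/3) \<longrightarrow>
            \<epsilon> = sqrt (1 / ((2 ^ n - 1)\<^sup>2 * real m * real K)) \<longrightarrow>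
            (\<forall>t j. j \<in> {1..m} \<longrightarrow> expl t j permutes {1..m} \<and> expl t j j = 1) \<longrightarrow>
            (\<forall>t\<in>{1..T}. \<forall>i\<in>{1..m}. rs t i \<le> n) \<longrightarrow>
            rtop1f_expected_total m T K \<epsilon> expl rs
              \<ge> best_total m T rs - C * (2 ^ n - 1) * real m powr (5/3) * real T powr (2/3))"
    by (intro exI[of _ 3] conjI allI impI rtop1f_upper_bound) simp_all
  show "(\<exists>C>0. \<forall>m T K \<epsilon> expl rs.
            m \<ge> 1 \<longrightarrow> K > 0 \<longrightarrow> K dvd T \<longrightarrow> m \<le> T div K \<longrightarrow>
            real K = real m powr (-1/3) * real T powr (2/3) \<longrightarrow>
            \<epsilon> = sqrt (1 / ((2 ^ 1 - 1)\<^sup>2 * real m * real K)) \<longrightarrow>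
            (\<forall>t j. j \<in> {1..m} \<longrightarrow> expl t j permutes {1..m} \<and> expl t j j = 1) \<longrightarrow>
            (\<forall>t\<in>{1..T}. \<forall>i\<in>{1..m}. rs t i \<le> 1) \<longrightarrow>
            rtop1f_expected_total m T K \<epsilon> expl rs
              \<ge> best_total m T rs - C * real m powr (5/3) * real T powr (2/3))"
  \<comment> \<open>The binary case is \<open>n = 1\<close>, where the factor
    \<open>2 ^ n - 1\<close> is 1 and the same constant works.\<close>
  proof (intro exI[of _ 3] conjI allI impI, goal_cases)
    case (2 m T K \<epsilon> expl rs)
    then show ?case using rtop1f_upper_bound[of m 1 K T \<epsilon> rs expl] by simp
  qed simp
qed (rule dcg_top1_lower_bound)

end
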